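(* Let $n \ge 1$ and let $X \subseteq \mathbb{FT}^n$ be a tropical polytope. Then $X$ is a projective $\mathbb{FT}$-module if and only if it has pure dimension equal to its generator dimension and its dual dimension (that is, there is an integer $k$ such that $X$ has pure dimension $k$, generator dimension $k$ and dual dimension $k$).
   Context: $\mathbb{FT}$ is the finitary tropical semiring: the set $\mathbb{R}$ with $a \oplus b = \max(a,b)$ and $a \otimes b = ab = a+b$ (usual addition); its multiplicative identity is the real number $0$. An $\mathbb{FT}$-module is a commutative semigroup $(M,\oplus)$ with a left action of $\mathbb{FT}$ satisfying $\lambda(\mu m) = (\lambda\mu)m$, $(\lambda\oplus\mu)m = \lambda m\oplus\mu m$, $\lambda(m\oplus m') = \lambda m\oplus\lambda m'$ and $0m = m$. Morphisms are maps preserving $\oplus$ and the action. $\mathbb{FT}^n$ is an $\mathbb{FT}$-module under componentwise maximum and $(\lambda x)_i = \lambda + x_i$, and is partially ordered componentwise. A tropical polytope in $\mathbb{FT}^n$ is a non-empty finitely generated submodule of $\mathbb{FT}^n$ (generated under $\oplus$ and scaling by $\mathbb{FT}$). A module $P$ is projective if for every morphism $g : P \to M$ and every surjective morphism $f : A \to M$ of $\mathbb{FT}$-modules there is a morphism $p : P \to A$ with $f \circ p = g$. The generator dimension of $X$ is the minimal cardinality of a generating set of $X$ under scaling and $\oplus$. The dual dimension of $X$ is the minimal cardinality of a generating set of $X$ under scaling and the operation of greatest lower bound within the poset $X$ (which may differ from the componentwise minimum). $X$ has pure dimension $k$ if every non-empty subset of $X$ that is open in $X$ (for the topology induced from the usual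 topology of $\mathbb{R}^n$) has topological dimension $k$. *)

theory Defs
  imports "HOL-Analysis.Analysis" "HOL-Library.Lub_Glb" "HOL-Library.Extended_Nat"
begin

section \<open>Modules over the finitary tropical semiring\<close>

text \<open>
  The semiring is \<^typ>\<open>real\<close> with \<^const>\<open>max\<close> as addition, \<open>+\<close> as multiplication and
  the real number \<open>0\<close> as multiplicative identity. Modules are given by an explicit carrier, so that
  one can quantify over all modules whose elements are drawn from a given type.
\<close>

record 'a ft_struct =
  ft_carrier :: "'a set"
  ft_add :: "'a \<Rightarrow> 'a \<Rightarrow> 'a"
  ft_smult :: "real \<Rightarrow> 'a \<Rightarrow> 'a"

locale ft_module =
  fixes M :: "'a ft_struct"
  assumes add_closed: "\<lbrakk>x \<in> ft_carrier M; y \<in> ft_carrier M\<rbrakk> \<Longrightarrow> ft_add M x y \<in> ft_carrier M"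
    and smult_closed: "x \<in> ft_carrier M \<Longrightarrow> ft_smult M a x \<in> ft_carrier M"
    and add_assoc: "\<lbrakk>x \<in> ft_carrier M; y \<in> ft_carrier M; z \<in> ft_carrier M\<rbrakk>
          \<Longrightarrow> ft_add M (ft_add M x y) z = ft_add M x (ft_add M y z)"
    and add_commute: "\<lbrakk>x \<in> ft_carrier M; y \<in> ft_carrier M\<rbrakk> \<Longrightarrow> ft_add M x y = ft_add M y x"
    and smult_smult: "x \<in> ft_carrier M \<Longrightarrow> ft_smult M a (ft_smult M b x) = ft_smult M (a + b) x"
    and max_smult: "x \<in> ft_carrier M
          \<Longrightarrow> ft_smult M (max a b) x = ft_add M (ft_smult M a x) (ft_smult M b x)"
    and smult_add: "\<lbrakk>x \<in> ft_carrier M; y \<in> ft_carrier M\<rbrakk>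
          \<Longrightarrow> ft_smult M a (ft_add M x y) = ft_add M (ft_smult M a x) (ft_smult M a y)"
    and zero_smult: "x \<in> ft_carrier M \<Longrightarrow> ft_smult M 0 x = x"

definition ft_hom :: "'a ft_struct \<Rightarrow> 'b ft_struct \<Rightarrow> ('a \<Rightarrow> 'b) set" where
  "ft_hom M N = {f. f ` ft_carrier M \<subseteq> ft_carrier N \<and>
     (\<forall>x\<in>ft_carrier M. \<forall>y\<in>ft_carrier M. f (ft_add M x y) = ft_add N (f x) (f y)) \<and>
     (\<forall>a. \<forall>x\<in>ft_carrier M. f (ft_smult M a x) = ft_smult N a (f x))}"

text \<open>
  HOL cannot quantify over all types inside a formula, so the type \<open>'u\<close> serves as the universe
  from which the test modules \<open>A\<close> and \<open>M\<close> are taken. Projectivity in the unrestricted sense is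
  obtained by letting \<open>'u\<close> range over all types; the universe has to be large enough for free
  modules covering \<open>P\<close> to live in it (over a one-element type
  every module would be projective). For a submodule of \<^typ>\<open>real ^ 'n\<close> any universe of the form
  \<^typ>\<open>'u + real ^ 'n\<close> is large enough, and since \<open>'u\<close> is arbitrary such universes impose no bound
  on the size of the test modules.
\<close>

definition ft_projective :: "'u itself \<Rightarrow> 'a ft_struct \<Rightarrow> bool" where
  "ft_projective TYPE('u) P \<longleftrightarrow> ft_module P \<and>
     (\<forall>(A :: 'u ft_struct) (M :: 'u ft_struct) f g.
        ft_module A \<and> ft_module M \<and> g \<in> ft_hom P M \<and>
        f \<in> ft_hom A M \<and> f ` ft_carrier A = ft_carrier M
        \<longrightarrow> (\<exists>p \<in> ft_hom P A. \<forall>x\<in>ft_carrier P. f (p x) = g x))"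


section \<open>Tropical polytopes\<close>

text \<open>
  On \<^typ>\<open>real ^ 'n\<close> the library operation \<^const>\<open>sup\<close> is the componentwise maximum and \<open>\<le>\<close> is the
  componentwise order.
\<close>

definition ft_scale :: "real \<Rightarrow> real ^ 'n \<Rightarrow> real ^ 'n" where
  "ft_scale a x = (\<chi> i. a + x $ i)"

definition ft_submodule :: "(real ^ 'n) set \<Rightarrow> bool" where
  "ft_submodule X \<longleftrightarrow> (\<forall>x\<in>X. \<forall>y\<in>X. sup x y \<in> X) \<and> (\<forall>a. \<forall>x\<in>X. ft_scale a x \<in> X)"

definition ft_of :: "(real ^ 'n) set \<Rightarrow> (real ^ 'n) ft_struct" where
  "ft_of X = \<lparr>ft_carrier = X, ft_add = sup, ft_smult = ft_scale\<rparr>"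

definition tropical_polytope :: "(real ^ 'n) set \<Rightarrow> bool" where
  "tropical_polytope X \<longleftrightarrow> X \<noteq> {} \<and> (\<exists>S. finite S \<and> ft_submodule hull S = X)"

lemma ft_module_ft_of:
  assumes "ft_submodule X"
  shows "ft_module (ft_of X)"
  using assms
  by unfold_locales
    (auto simp: ft_submodule_def ft_of_def ft_scale_def vec_eq_iff sup_vec_def sup_max
      max_add_distrib_left max_add_distrib_right add.assoc max.assoc max.commute)


section \<open>Notions of dimension\<close>

text \<open>The infimum of the empty set in \<^typ>\<open>enat\<close> is \<open>\<infinity>\<close>.\<close>

definition generator_dim :: "(real ^ 'n) set \<Rightarrow> enat" where
  "generator_dim X = (INF S \<in> {S. finite S \<and> ft_submodule hull S = X}. enat (card S))"

text \<open>
  Closure under scaling and under those greatest lower bounds that are formed in the poset \<open>X\<close>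
  (\<^term>\<open>isGlb X {x, y} z\<close>), rather than under the componentwise minimum.
\<close>

definition dual_closed :: "(real ^ 'n) set \<Rightarrow> (real ^ 'n) set \<Rightarrow> bool" where
  "dual_closed X T \<longleftrightarrow> (\<forall>x\<in>T. \<forall>y\<in>T. \<forall>z. isGlb X {x, y} z \<longrightarrow> z \<in> T) \<and>
     (\<forall>a. \<forall>x\<in>T. ft_scale a x \<in> T)"

definition dual_dim :: "(real ^ 'n) set \<Rightarrow> enat" where
  "dual_dim X = (INF S \<in> {S. finite S \<and> dual_closed X hull S = X}. enat (card S))"

text \<open>
  Topological dimension is Lebesgue covering dimension: the least \<open>d\<close> such that every open cover
  has an open refinement in which each point lies in at most \<open>d + 1\<close> members. The empty space,
  whose dimension is conventionally \<open>-1\<close>, gets the value \<open>0\<close> here; it does not occur below.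
\<close>

definition covering_dim_le :: "'a topology \<Rightarrow> nat \<Rightarrow> bool" where
  "covering_dim_le T d \<longleftrightarrow>
     (\<forall>\<U>. (\<forall>U\<in>\<U>. openin T U) \<and> \<Union>\<U> = topspace T \<longrightarrow>
        (\<exists>\<V>. (\<forall>V\<in>\<V>. openin T V) \<and> \<Union>\<V> = topspace T \<and> (\<forall>V\<in>\<V>. \<exists>U\<in>\<U>. V \<subseteq> U) \<and>
             (\<forall>x\<in>topspace T. finite {V\<in>\<V>. x \<in> V} \<and> card {V\<in>\<V>. x \<in> V} \<le> d + 1)))"

definition topological_dim :: "'a topology \<Rightarrow> enat" where
  "topological_dim T = (INF d \<in> {d. covering_dim_le T d}. enat d)"

definition pure_dim :: "(real ^ 'n) set \<Rightarrow> nat \<Rightarrow> bool" where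
  "pure_dim X k \<longleftrightarrow>
     (\<forall>U. openin (top_of_set X) U \<and> U \<noteq> {} \<longrightarrow> topological_dim (top_of_set U) = enat k)"

end

(*
  X is projective iff it has a dual basis: generators s and linear functionals c_s with
  x = max_s (c_s(x) + s) for all x in X.

  If S is a minimal generating set, a dual basis embeds X into R^S as the cone
  {y. y_s >= y_t + c_s(t)}, which is closed under minima and has non-empty interior; hence X has
  pure dimension |S|, and the points with coordinates (-c_t(s))_s generate it dually.

  Conversely, dual generators t yield order-reflecting functionals q_t, i.e. coordinates. Let r_s(x)
  be the greatest real with r_s(x) + s <= x. Outside finitely many hyperplanes
  q_t - q_t' = q_t(s) - q_t'(s) each s has exactly one t with q_t(x) = r_s(x) + q_t(s). If there are
  as many dual generators as generators, t is a bijective function of s, and this bijection is the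
  unique maximiser of an assignment problem, so it does not depend on x. By purity the hyperplanes
  are nowhere dense, so that r_s = q_t - q_t(s) on all of X, and the r_s are a dual basis.
*)

theory Submission
  imports Defs
begin

section \<open>Covering dimension: upper bounds\<close>

text \<open>Monotonicity of covering dimension under arbitrary subsets is a theorem in itself, so
  upper bounds are proved directly for any subset \<open>U\<close> on which finitely many real
  functions serve as coordinates: \<open>U\<close> is cut into zero-dimensional classes by counting
  the coordinates that lie in prescribed countable dense sets. Generic shifts of these sets remove
  one class on the hyperplanes. This is how purity yields density: a non-empty open set inside the
  hyperplanes would have dimension below k. A lower bound needs only one compact ball inside each
  open set, where Brouwer's theorem applies.

  The number of dual generators is used twice: it bounds the dimension from above, and its equality
  with the number of generators turns a surjection into a bijection. The cone has interior because
  irredundancy forces c_s(s) = 0 and c_s(t) + c_t(s) < 0 for s \<noteq> t; an interior point is the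
  ordinary average of the coordinate vectors of the generators.\<close>

definition zero_dim_set :: "'a::topological_space set \<Rightarrow> bool" where
  "zero_dim_set R \<longleftrightarrow> (\<forall>A B. closedin (top_of_set R) A \<and> closedin (top_of_set R) B \<and> A \<inter> B = {} \<longrightarrow>
     (\<exists>C. openin (top_of_set R) C \<and> closedin (top_of_set R) C \<and> A \<subseteq> C \<and> C \<inter> B = {}))"

section \<open>Zero-dimensional sets and their countable closed unions\<close>

lemma closedin_Diff_openin:
  "openin (top_of_set R) C \<Longrightarrow> closedin (top_of_set R) (R - C)"
  using closedin_diff[OF closedin_topspace, of "top_of_set R" C] by simp

text \<open>A Lindelof subcover is enumerated and each member loses its predecessors. The
  differences stay open because a finite union of clopen sets is closed, and \<open>mono\<close>
  preserves \<open>P\<close>.\<close>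

lemma clopen_partition:
  fixes R :: "'a::second_countable_topology set"
  assumes base: "\<And>x. x \<in> R \<Longrightarrow>
      \<exists>C. openin (top_of_set R) C \<and> closedin (top_of_set R) C \<and> x \<in> C \<and> P C"
    and mono: "\<And>C D. P C \<Longrightarrow> D \<subseteq> C \<Longrightarrow> P D"
  shows "\<exists>\<C>. disjoint \<C> \<and> \<Union>\<C> = R \<and> (\<forall>C\<in>\<C>. openin (top_of_set R) C \<and> P C)"
proof (cases "R = {}")
  case True
  then show ?thesis by (intro exI[of _ "{}"]) auto
next
  case False
  obtain N where N: "\<And>x. x \<in> R \<Longrightarrow>
      openin (top_of_set R) (N x) \<and> closedin (top_of_set R) (N x) \<and> x \<in> N x \<and> P (N x)"
    using base by metis
  obtain \<F> where \<F>: "\<F> \<subseteq> N ` R" "countable \<F>" "\<Union>\<F> = \<Union>(N ` R)"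
    using Lindelof_openin[of "N ` R" R] N by blast
  have "\<Union>(N ` R) = R"
    using N openin_subset by fastforce
  with \<F> have UF: "\<Union>\<F> = R" by simp
  with False have "\<F> \<noteq> {}" by auto
  define c where "c = from_nat_into \<F>"
  have rc: "range c = \<F>"
    unfolding c_def using \<open>\<F> \<noteq> {}\<close> \<F>(2) by (rule range_from_nat_into)
  have c: "openin (top_of_set R) (c n) \<and> closedin (top_of_set R) (c n) \<and> P (c n)" for n
  proof -
    have "c n \<in> N ` R" using rc \<F>(1) by blast
    then show ?thesis using N by auto
  qed
  have op: "openin (top_of_set R) (disjointed c n)" for n
    unfolding disjointed_def using c by (intro openin_diff closedin_Union) auto
  show ?thesis
  proof (intro exI conjI ballI)
    show "disjoint (range (disjointed c))"
      using disjoint_family_disjointed[of c] by (rule disjoint_family_on_disjoint_image)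
    show "\<Union>(range (disjointed c)) = R"
      using UN_disjointed_eq[of c] rc UF by simp
    fix C assume "C \<in> range (disjointed c)"
    then obtain n where "C = disjointed c n" by auto
    then show "openin (top_of_set R) C" "P C"
      using op[of n] c[of n] mono[of "c n"] disjointed_subset[of c n] by auto
  qed
qed

text \<open>The partition is taken for the property of missing \<open>A\<close> or missing
  \<open>B\<close>. Members that meet \<open>A\<close> then avoid \<open>B\<close>, and their union
  is clopen because its complement is the union of the others.\<close>

lemma zero_dim_set_base:
  fixes R :: "'a::second_countable_topology set"
  assumes base: "\<And>x W. x \<in> R \<Longrightarrow> openin (top_of_set R) W \<Longrightarrow> x \<in> W \<Longrightarrow>
      \<exists>C. openin (top_of_set R) C \<and> closedin (top_of_set R) C \<and> x \<in> C \<and> C \<subseteq> W"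
  shows "zero_dim_set R"
  unfolding zero_dim_set_def
proof (intro allI impI; elim conjE)
  fix A B assume A: "closedin (top_of_set R) A" and B: "closedin (top_of_set R) B" and AB: "A \<inter> B = {}"
  define P where "P C \<longleftrightarrow> C \<inter> A = {} \<or> C \<inter> B = {}" for C
  have base': "\<exists>C. openin (top_of_set R) C \<and> closedin (top_of_set R) C \<and> x \<in> C \<and> P C" if x: "x \<in> R" for x
  proof -
    have "openin (top_of_set R) (R - A)" "openin (top_of_set R) (R - B)"
      using A B by (auto simp: closedin_def)
    moreover have "x \<in> R - A \<or> x \<in> R - B" using x AB by auto
    ultimately obtain C where C: "openin (top_of_set R) C" "closedin (top_of_set R) C" "x \<in> C"
        "C \<subseteq> R - A \<or> C \<subseteq> R - B"
      using base[OF x] by (elim disjE) meson+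
    then have "P C" unfolding P_def by auto
    then show ?thesis using C by blast
  qed
  have mono: "P D" if "P C" "D \<subseteq> C" for C D using that unfolding P_def by blast
  have "\<exists>\<C>. disjoint \<C> \<and> \<Union>\<C> = R \<and> (\<forall>C\<in>\<C>. openin (top_of_set R) C \<and> P C)"
  proof (rule clopen_partition[where P = P])
    show "\<exists>C. openin (top_of_set R) C \<and> closedin (top_of_set R) C \<and> x \<in> C \<and> P C" if "x \<in> R" for x
      using that by (rule base')
    show "P D" if "P C" "D \<subseteq> C" for C D
      using that by (rule mono)
  qed
  then obtain \<C> where C: "disjoint \<C>" "\<Union>\<C> = R" "\<forall>C\<in>\<C>. openin (top_of_set R) C \<and> P C"
    by blast
  define C1 where "C1 = \<Union>{C\<in>\<C>. C \<inter> A \<noteq> {}}"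
  have o1: "openin (top_of_set R) C1" unfolding C1_def using C by blast
  have "openin (top_of_set R) (\<Union>{C\<in>\<C>. C \<inter> A = {}})" using C by blast
  moreover have "R - C1 = \<Union>{C\<in>\<C>. C \<inter> A = {}}"
    unfolding C1_def using C(1,2) unfolding disjoint_def by blast
  moreover have "C1 \<subseteq> R" using openin_subset[OF o1] by simp
  ultimately have "closedin (top_of_set R) C1"
    unfolding closedin_def by simp
  moreover have "A \<subseteq> C1" unfolding C1_def using C(2) closedin_subset[OF A] by auto
  moreover have "C1 \<inter> B = {}" unfolding C1_def using C(3) by (auto simp: P_def)
  ultimately show "\<exists>C. openin (top_of_set R) C \<and> closedin (top_of_set R) C \<and> A \<subseteq> C \<and> C \<inter> B = {}"
    using o1 by blast
qed

text \<open>Members of a clopen partition are open in \<open>R\<close> only. Fattening them by balls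
  of half the radius within which they contain all of \<open>R\<close> makes them open in
  \<open>U\<close> and keeps them disjoint: if two half-balls met, the larger full ball would
  contain the other centre.\<close>

lemma zero_dim_set_disjoint_refinement:
  fixes R :: "'a::{metric_space, second_countable_topology} set"
  assumes "zero_dim_set R" "R \<subseteq> U"
    and op: "\<And>W. W \<in> \<U> \<Longrightarrow> openin (top_of_set U) W" and cov: "R \<subseteq> \<Union>\<U>"
  shows "\<exists>\<V>. disjoint \<V> \<and> (\<forall>V\<in>\<V>. openin (top_of_set U) V) \<and> R \<subseteq> \<Union>\<V> \<and>
    (\<forall>V\<in>\<V>. \<exists>W\<in>\<U>. V \<subseteq> W)"
proof -
  define P where "P C \<longleftrightarrow> (\<exists>W\<in>\<U>. C \<subseteq> W)" for C
  have base': "\<exists>C. openin (top_of_set R) C \<and> closedin (top_of_set R) C \<and> x \<in> C \<and> P C" if x: "x \<in> R" for x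
  proof -
    obtain W where W: "W \<in> \<U>" "x \<in> W" using x cov by auto
    have "openin (top_of_set R) (R \<inter> W)"
      using op[OF W(1)] \<open>R \<subseteq> U\<close> by (auto simp: openin_open)
    then have "closedin (top_of_set R) (R - W)"
      using closedin_Diff_openin[of R "R \<inter> W"] by (simp add: Diff_Int)
    moreover have "closedin (top_of_set R) {x}"
      using x by (intro closed_subset) auto
    ultimately obtain C where "openin (top_of_set R) C \<and> closedin (top_of_set R) C \<and> {x} \<subseteq> C \<and> C \<inter> (R - W) = {}"
      using assms(1)[unfolded zero_dim_set_def, rule_format, of "{x}" "R - W"] W(2) by auto
    then have C: "openin (top_of_set R) C" "closedin (top_of_set R) C" "x \<in> C" "C \<inter> (R - W) = {}"
      by auto
    have "C \<subseteq> R" using openin_subset[OF C(1)] by simp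
    then have "P C" unfolding P_def using W C(4) by blast
    then show ?thesis using C by blast
  qed
  have mono: "P D" if "P C" "D \<subseteq> C" for C D using that unfolding P_def by blast
  have "\<exists>\<C>. disjoint \<C> \<and> \<Union>\<C> = R \<and> (\<forall>C\<in>\<C>. openin (top_of_set R) C \<and> P C)"
  proof (rule clopen_partition[where P = P])
    show "\<exists>C. openin (top_of_set R) C \<and> closedin (top_of_set R) C \<and> x \<in> C \<and> P C" if "x \<in> R" for x
      using that by (rule base')
    show "P D" if "P C" "D \<subseteq> C" for C D
      using that by (rule mono)
  qed
  then obtain \<C> where \<C>: "disjoint \<C>" "\<Union>\<C> = R" "\<forall>C\<in>\<C>. openin (top_of_set R) C \<and> P C"
    by blast
  have "\<exists>W\<in>\<U>. C \<subseteq> W" if "C \<in> \<C>" for C using \<C>(3) that by (auto simp: P_def)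
  then obtain ow where ow: "\<And>C. C \<in> \<C> \<Longrightarrow> ow C \<in> \<U> \<and> C \<subseteq> ow C" by metis
  have "\<exists>e>0. \<forall>y\<in>R. dist y x < e \<longrightarrow> y \<in> C" if "C \<in> \<C>" "x \<in> C" for C x
    using \<C>(3) that unfolding openin_euclidean_subtopology_iff by blast
  then have "\<forall>C x. \<exists>e. C \<in> \<C> \<longrightarrow> x \<in> C \<longrightarrow> e > 0 \<and> (\<forall>y\<in>R. dist y x < e \<longrightarrow> y \<in> C)"
    by blast
  then obtain r where r: "\<And>C x. C \<in> \<C> \<Longrightarrow> x \<in> C \<Longrightarrow> r C x > 0 \<and> (\<forall>y\<in>R. dist y x < r C x \<longrightarrow> y \<in> C)"
    unfolding choice_iff by blast
  define w where "w C = ow C \<inter> (\<Union>x\<in>C. ball x (r C x / 2))" for C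
  have ww: "w C \<inter> w D = {}" if "C \<in> \<C>" "D \<in> \<C>" "C \<noteq> D" for C D
  proof (rule ccontr)
    assume "w C \<inter> w D \<noteq> {}"
    then obtain u x y where u: "x \<in> C" "y \<in> D" "dist x u < r C x / 2" "dist y u < r D y / 2"
      unfolding w_def by auto
    have "dist x y < r C x / 2 + r D y / 2"
      using u dist_triangle2[of x y u] by linarith
    then have "dist x y < r C x \<or> dist x y < r D y" by linarith
    moreover have "x \<in> R" "y \<in> R" using u that \<C>(2) by auto
    ultimately have "y \<in> C \<or> x \<in> D"
      using r[OF that(1) u(1)] r[OF that(2) u(2)] by (metis dist_commute)
    then show False using u that \<C>(1) unfolding disjoint_def by blast
  qed
  show ?thesis
  proof (intro exI[of _ "w ` \<C>"] conjI ballI)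
    show "disjoint (w ` \<C>)"
      unfolding disjoint_def using ww by blast
    fix V assume V: "V \<in> w ` \<C>"
    then show "\<exists>W\<in>\<U>. V \<subseteq> W" using ow unfolding w_def by blast
    show "openin (top_of_set U) V"
    proof -
      obtain C where C: "C \<in> \<C>" "V = w C" using V by blast
      show ?thesis unfolding C w_def
        using op ow[OF C(1)] by (auto intro!: openin_Int_open)
    qed
  next
    show "R \<subseteq> \<Union>(w ` \<C>)"
    proof
      fix x assume "x \<in> R"
      then obtain C where "C \<in> \<C>" "x \<in> C" using \<C>(2) by auto
      then have "x \<in> w C" unfolding w_def using ow[of C] r[of C x] by (auto intro!: bexI[of _ x])
      then show "x \<in> \<Union>(w ` \<C>)" using \<open>C \<in> \<C>\<close> by auto
    qed
  qed
qed

text \<open>Countable closed sum theorem in dimension zero: open neighbourhoods of \<open>A\<close>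
  and \<open>B\<close> absorb \<open>P 0\<close>, \<open>P 1\<close> and so on one by one, and in
  the limit they partition \<open>R\<close>.\<close>

lemma zero_dim_set_countable_Union:
  fixes R :: "'a::metric_space set" and P :: "nat \<Rightarrow> 'a set"
  assumes zd: "\<And>m. zero_dim_set (P m)" and cl: "\<And>m. closedin (top_of_set R) (P m)"
    and R: "R = (\<Union>m. P m)"
  shows "zero_dim_set R"
  unfolding zero_dim_set_def
proof (intro allI impI; elim conjE)
  let ?T = "top_of_set R"
  fix A B assume A: "closedin ?T A" and B: "closedin ?T B" and AB: "A \<inter> B = {}"
  have norm: "normal_space ?T"
    by (simp add: metrizable_imp_normal_space metrizable_space_subtopology metrizable_space_euclidean)
  have sep: "\<exists>U V. openin ?T U \<and> openin ?T V \<and> S \<subseteq> U \<and> T \<subseteq> V \<and> ?T closure_of U \<inter> ?T closure_of V = {}"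
    if "closedin ?T S" "closedin ?T T" "S \<inter> T = {}" for S T
    using norm that unfolding normal_space_disjoint_closures disjnt_def by auto
  have clo: "K \<subseteq> ?T closure_of K" if "openin ?T K" for K
    by (rule closure_of_subset[OF openin_subset[OF that]])
  \<comment> \<open>Disjoint closures, rather than merely disjoint sets, have disjoint closed traces
    on the next \<open>P n\<close>, which its zero-dimensionality can separate.\<close>
  define inv where "inv GH \<longleftrightarrow> openin ?T (fst GH) \<and> openin ?T (snd GH) \<and> A \<subseteq> fst GH \<and> B \<subseteq> snd GH \<and>
      ?T closure_of (fst GH) \<inter> ?T closure_of (snd GH) = {}" for GH
  define nxt where "nxt m GH GH' \<longleftrightarrow> fst GH \<subseteq> fst GH' \<and> snd GH \<subseteq> snd GH' \<and> P m \<subseteq> fst GH' \<union> snd GH'" for m GH GH'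
  have "\<exists>f. \<forall>n. inv (f n) \<and> nxt n (f n) (f (Suc n))"
  proof (rule dependent_nat_choice)
    show "\<exists>x. inv x" using sep[OF A B AB] unfolding inv_def by auto
  next
    fix GH n assume inv: "inv GH"
    obtain G H where GH: "GH = (G, H)" by (cases GH)
    have subGH: "G \<subseteq> ?T closure_of G" "H \<subseteq> ?T closure_of H"
      using inv clo unfolding inv_def GH by simp_all
    have "P n \<subseteq> R" using R by auto
    have "closedin (top_of_set (P n)) (P n \<inter> ?T closure_of K)" for K
      using closedin_closure_of[of ?T K] cl[of n] \<open>P n \<subseteq> R\<close>
      by (rule_tac closedin_subset_trans[of R]) (auto intro: closedin_Int)
    moreover have "(P n \<inter> ?T closure_of G) \<inter> (P n \<inter> ?T closure_of H) = {}"
      using inv unfolding inv_def GH by auto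
    ultimately obtain C where C: "openin (top_of_set (P n)) C" "closedin (top_of_set (P n)) C"
      "P n \<inter> ?T closure_of G \<subseteq> C" "C \<inter> (P n \<inter> ?T closure_of H) = {}"
      using zd[of n] unfolding zero_dim_set_def by meson
    have "closedin (top_of_set (P n)) (P n - C)" using C(1)
      by (rule closedin_Diff_openin)
    then have c1: "closedin ?T (?T closure_of H \<union> (P n - C))"
      using cl[of n] by (intro closedin_Un closedin_closure_of) (rule closedin_trans)
    have c2: "closedin ?T (?T closure_of G \<union> C)"
      using cl[of n] C(2) by (intro closedin_Un closedin_closure_of) (rule closedin_trans)
    have "C \<subseteq> P n" using openin_subset[OF C(1)] by simp
    then have "(?T closure_of G \<union> C) \<inter> (?T closure_of H \<union> (P n - C)) = {}"
      using C(3,4) inv unfolding inv_def GH by auto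
    from sep[OF c2 c1 this] obtain G' H' where G': "openin ?T G'" "openin ?T H'"
      "?T closure_of G \<union> C \<subseteq> G'" "?T closure_of H \<union> (P n - C) \<subseteq> H'"
      "?T closure_of G' \<inter> ?T closure_of H' = {}" by blast
    have "inv (G', H') \<and> nxt n GH (G', H')"
      using G' subGH inv unfolding inv_def nxt_def GH by auto
    then show "\<exists>y. inv y \<and> nxt n GH y" by blast
  qed
  then obtain f where f: "\<And>n. inv (f n)" "\<And>n. nxt n (f n) (f (Suc n))" by blast
  define G where "G = (\<Union>n. fst (f n))"
  define H where "H = (\<Union>n. snd (f n))"
  have oG: "openin ?T G" "openin ?T H" unfolding G_def H_def using f(1) unfolding inv_def by auto
  have sub: "fst (f n) \<subseteq> ?T closure_of fst (f n)" "snd (f n) \<subseteq> ?T closure_of snd (f n)" for n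
    using f(1)[of n] clo unfolding inv_def by simp_all
  have mono: "fst (f m) \<subseteq> fst (f n) \<and> snd (f m) \<subseteq> snd (f n)" if "m \<le> n" for m n
    using that
  proof (induction rule: dec_induct)
    case (step n)
    then show ?case using f(2)[of n] unfolding nxt_def by blast
  qed simp
  have dis: "G \<inter> H = {}"
  proof (rule ccontr)
    assume "G \<inter> H \<noteq> {}"
    then obtain x m n where "x \<in> fst (f m)" "x \<in> snd (f n)" unfolding G_def H_def by auto
    then have "x \<in> fst (f (max m n))" "x \<in> snd (f (max m n))"
      using mono[of m "max m n"] mono[of n "max m n"] by auto
    then show False using sub[of "max m n"] f(1)[of "max m n"] unfolding inv_def by auto
  qed
  have "P m \<subseteq> G \<union> H" for m using f(2)[of m] unfolding nxt_def G_def H_def by blast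
  then have "R \<subseteq> G \<union> H" using R by auto
  then have "G = R - H" using dis openin_subset[OF oG(1)] by auto
  then have "closedin ?T G" using closedin_Diff_openin[OF oG(2)] by simp
  moreover have "A \<subseteq> G" "B \<subseteq> H" using f(1)[of 0] unfolding inv_def G_def H_def by auto
  ultimately show "\<exists>C. openin ?T C \<and> closedin ?T C \<and> A \<subseteq> C \<and> C \<inter> B = {}"
    using oG dis by blast
qed

text \<open>Each class \<open>R j\<close> has a disjoint refinement, so a point lies in at most one
  member per class; the bound \<open>d + 1\<close> counts the classes
  \<open>j \<le> d\<close>.\<close>

lemma covering_dim_le_zero_dim_Union:
  fixes U :: "'a::{metric_space, second_countable_topology} set"
  assumes zd: "\<And>j. j \<le> d \<Longrightarrow> zero_dim_set (R j)" and U: "U = (\<Union>j\<le>d. R j)"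
  shows "covering_dim_le (top_of_set U) d"
  unfolding covering_dim_le_def
proof (intro allI impI; elim conjE)
  fix \<U> assume op: "\<forall>W\<in>\<U>. openin (top_of_set U) W" and cov: "\<Union>\<U> = topspace (top_of_set U)"
  have "\<exists>\<V>. disjoint \<V> \<and> (\<forall>V\<in>\<V>. openin (top_of_set U) V) \<and> R j \<subseteq> \<Union>\<V> \<and> (\<forall>V\<in>\<V>. \<exists>W\<in>\<U>. V \<subseteq> W)"
    if "j \<le> d" for j
  proof -
    have "R j \<subseteq> U" using U that by auto
    then show ?thesis
      using zero_dim_set_disjoint_refinement[OF zd[OF that] \<open>R j \<subseteq> U\<close>, of \<U>] op cov by simp
  qed
  then obtain v where v: "\<And>j. j \<le> d \<Longrightarrow> disjoint (v j) \<and> (\<forall>V\<in>v j. openin (top_of_set U) V) \<and>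
      R j \<subseteq> \<Union>(v j) \<and> (\<forall>V\<in>v j. \<exists>W\<in>\<U>. V \<subseteq> W)" by metis
  define \<V> where "\<V> = (\<Union>j\<le>d. v j)"
  have "finite {V\<in>\<V>. x \<in> V} \<and> card {V\<in>\<V>. x \<in> V} \<le> d + 1" for x
  proof -
    define q where "q j = (SOME V. V \<in> v j \<and> x \<in> V)" for j
    have "{V\<in>\<V>. x \<in> V} \<subseteq> q ` {..d}"
    proof
      fix V assume "V \<in> {V\<in>\<V>. x \<in> V}"
      then obtain j where j: "j \<le> d" "V \<in> v j" "x \<in> V" unfolding \<V>_def by auto
      then have "q j \<in> v j \<and> x \<in> q j" unfolding q_def by (metis (mono_tags, lifting) someI)
      then have "q j = V" using v[OF j(1)] j unfolding disjoint_def by blast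
      then show "V \<in> q ` {..d}" using j by auto
    qed
    then show ?thesis
      using finite_subset[of _ "q ` {..d}"] surj_card_le[of "{..d}" _ q] by simp
  qed
  moreover have "\<forall>V\<in>\<V>. openin (top_of_set U) V" "\<forall>V\<in>\<V>. \<exists>W\<in>\<U>. V \<subseteq> W"
    unfolding \<V>_def using v by auto
  moreover have "\<Union>\<V> = topspace (top_of_set U)"
  proof
    show "\<Union>\<V> \<subseteq> topspace (top_of_set U)" using calculation(2) openin_subset by blast
    show "topspace (top_of_set U) \<subseteq> \<Union>\<V>" using U v unfolding \<V>_def by fastforce
  qed
  ultimately show "\<exists>\<V>. (\<forall>V\<in>\<V>. openin (top_of_set U) V) \<and> \<Union>\<V> = topspace (top_of_set U) \<and>
      (\<forall>V\<in>\<V>. \<exists>W\<in>\<U>. V \<subseteq> W) \<and> (\<forall>x\<in>topspace (top_of_set U).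
      finite {V\<in>\<V>. x \<in> V} \<and> card {V\<in>\<V>. x \<in> V} \<le> d + 1)"
    by blast
qed

corollary zero_dim_set_countable_UN:
  fixes R :: "'a::metric_space set"
  assumes "countable K" and zd: "\<And>k. k \<in> K \<Longrightarrow> zero_dim_set (P k)"
    and cl: "\<And>k. k \<in> K \<Longrightarrow> closedin (top_of_set R) (P k)" and R: "R = (\<Union>k\<in>K. P k)"
  shows "zero_dim_set R"
proof (cases "K = {}")
  case True
  then show ?thesis using R by (auto simp: zero_dim_set_def)
next
  case False
  have K: "from_nat_into K n \<in> K" for n
    using False by (rule from_nat_into)
  show ?thesis
  proof (rule zero_dim_set_countable_Union)
    show "zero_dim_set (P (from_nat_into K m))" for m by (rule zd[OF K])
    show "closedin (top_of_set R) (P (from_nat_into K m))" for m by (rule cl[OF K])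
    have "(\<Union>k\<in>K. P k) = (\<Union>k\<in>range (from_nat_into K). P k)"
      by (simp only: range_from_nat_into[OF False assms(1)])
    then show "R = (\<Union>m. P (from_nat_into K m))" using R by simp
  qed
qed

text \<open>
  The points with exactly \<open>j\<close> coordinates in the dense sets form a zero-dimensional set: it is the
  countable union of the closed pieces on which those coordinates and their values are prescribed,
  and on such a piece boxes with endpoints in the dense sets are clopen.
\<close>

lemma covering_dim_le_few_coordinates:
  fixes U :: "'a::{metric_space, second_countable_topology} set" and \<phi> :: "'i \<Rightarrow> 'a \<Rightarrow> real"
  assumes fin: "finite I" and cont: "\<And>i. i \<in> I \<Longrightarrow> continuous_on U (\<phi> i)"
    and emb: "\<And>x e. x \<in> U \<Longrightarrow> e > 0 \<Longrightarrow>
      \<exists>\<delta>>0. \<forall>y\<in>U. (\<forall>i\<in>I. \<bar>\<phi> i y - \<phi> i x\<bar> < \<delta>) \<longrightarrow> dist y x < e"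
    and cnt: "\<And>i. i \<in> I \<Longrightarrow> countable (D i)"
    and dense: "\<And>i a b. i \<in> I \<Longrightarrow> a < b \<Longrightarrow> \<exists>q\<in>D i. a < q \<and> q < b"
    and few: "\<And>x. x \<in> U \<Longrightarrow> card {i\<in>I. \<phi> i x \<in> D i} \<le> d"
  shows "covering_dim_le (top_of_set U) d"
proof (rule covering_dim_le_zero_dim_Union)
  define R where "R j = {x\<in>U. card {i\<in>I. \<phi> i x \<in> D i} = j}" for j
  show "U = (\<Union>j\<le>d. R j)" unfolding R_def using few by auto
  fix j
  define K where "K = (SIGMA J:{J\<in>Pow I. card J = j}. Pi\<^sub>E J D)"
  define P where "P = (\<lambda>(J, c). {x\<in>R j. \<forall>i\<in>J. \<phi> i x = c i})"
  have RU: "R j \<subseteq> U" unfolding R_def by auto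
  show "zero_dim_set (R j)"
  proof (rule zero_dim_set_countable_UN)
    show "countable K"
      unfolding K_def
    proof (rule countable_SIGMA)
      show "countable {J \<in> Pow I. card J = j}" using fin by (simp add: countable_finite)
      show "countable (Pi\<^sub>E J D)" if "J \<in> {J \<in> Pow I. card J = j}" for J
        using that fin cnt by (intro countable_PiE) (auto intro: finite_subset)
    qed
    show "R j = (\<Union>k\<in>K. P k)"
    proof
      show "R j \<subseteq> (\<Union>k\<in>K. P k)"
      proof
        fix x assume x: "x \<in> R j"
        define J where "J = {i\<in>I. \<phi> i x \<in> D i}"
        have "(J, restrict (\<lambda>i. \<phi> i x) J) \<in> K"
          using x unfolding K_def J_def R_def by auto
        moreover have "x \<in> P (J, restrict (\<lambda>i. \<phi> i x) J)" using x unfolding P_def by simp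
        ultimately show "x \<in> (\<Union>k\<in>K. P k)" by blast
      qed
      show "(\<Union>k\<in>K. P k) \<subseteq> R j" unfolding P_def by auto
    qed
    fix k assume "k \<in> K"
    then obtain J c where k: "k = (J, c)" and J: "J \<subseteq> I" "card J = j" "c \<in> Pi\<^sub>E J D"
      unfolding K_def by auto
    have contR: "continuous_on (R j) (\<phi> i)" if "i \<in> I" for i
      using cont[OF that] RU by (rule continuous_on_subset)
    have "P k = \<Inter>(insert (R j) ((\<lambda>i. R j \<inter> \<phi> i -` {c i}) ` J))"
      unfolding P_def k by auto
    moreover have "closedin (top_of_set (R j)) (\<Inter>(insert (R j) ((\<lambda>i. R j \<inter> \<phi> i -` {c i}) ` J)))"
    proof (rule closedin_Inter)
      fix S assume "S \<in> insert (R j) ((\<lambda>i. R j \<inter> \<phi> i -` {c i}) ` J)"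
      then show "closedin (top_of_set (R j)) S"
        using contR J by (auto intro!: continuous_closedin_preimage)
    qed simp
    ultimately show "closedin (top_of_set (R j)) (P k)" by simp
    have PR: "P k \<subseteq> R j" unfolding P_def k by auto
    \<comment> \<open>Exactly \<open>card J\<close> coordinates lie in the dense sets, and those in
      \<open>J\<close> already do.\<close>
    have nD: "\<phi> i x \<notin> D i" if "x \<in> P k" "i \<in> I - J" for x i
    proof -
      have "J \<subseteq> {i\<in>I. \<phi> i x \<in> D i}"
        using that J unfolding P_def k by auto
      moreover have "card {i\<in>I. \<phi> i x \<in> D i} = card J" using that PR J unfolding R_def by auto
      ultimately have "J = {i\<in>I. \<phi> i x \<in> D i}" using fin by (intro card_subset_eq) auto
      then show ?thesis using that by auto
    qed
    show "zero_dim_set (P k)"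
    proof (rule zero_dim_set_base)
      fix x W assume x: "x \<in> P k" and W: "openin (top_of_set (P k)) W" "x \<in> W"
      obtain e where e: "e > 0" "\<And>y. y \<in> P k \<Longrightarrow> dist y x < e \<Longrightarrow> y \<in> W"
        using W unfolding openin_euclidean_subtopology_iff by blast
      obtain \<delta> where \<delta>: "\<delta> > 0" "\<And>y. y \<in> U \<Longrightarrow> (\<forall>i\<in>I. \<bar>\<phi> i y - \<phi> i x\<bar> < \<delta>) \<Longrightarrow> dist y x < e"
        using emb[of x e] x PR RU e(1) by blast
      have "\<exists>q\<in>D i. \<phi> i x - \<delta> < q \<and> q < \<phi> i x" if "i \<in> I - J" for i
        using dense[of i "\<phi> i x - \<delta>" "\<phi> i x"] that \<delta>(1) by auto
      then obtain a where a: "\<And>i. i \<in> I - J \<Longrightarrow> a i \<in> D i \<and> \<phi> i x - \<delta> < a i \<and> a i < \<phi> i x"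
        by metis
      have "\<exists>q\<in>D i. \<phi> i x < q \<and> q < \<phi> i x + \<delta>" if "i \<in> I - J" for i
        using dense[of i "\<phi> i x" "\<phi> i x + \<delta>"] that \<delta>(1) by auto
      then obtain b where b: "\<And>i. i \<in> I - J \<Longrightarrow> b i \<in> D i \<and> \<phi> i x < b i \<and> b i < \<phi> i x + \<delta>"
        by metis
      define C where "C = {y\<in>P k. \<forall>i\<in>I-J. a i < \<phi> i y \<and> \<phi> i y < b i}"
      have contP: "continuous_on (P k) (\<phi> i)" if "i \<in> I" for i
        using contR[OF that] PR by (rule continuous_on_subset)
      have "C = (\<Inter>i\<in>I-J. P k \<inter> \<phi> i -` {a i<..<b i}) \<inter> topspace (top_of_set (P k))"
        unfolding C_def by auto
      moreover have "openin (top_of_set (P k)) ((\<Inter>i\<in>I-J. P k \<inter> \<phi> i -` {a i<..<b i}) \<inter> topspace (top_of_set (P k)))"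
        using fin contP by (intro openin_INT continuous_openin_preimage_gen) auto
      ultimately have oC: "openin (top_of_set (P k)) C" by simp
      \<comment> \<open>By \<open>nD\<close> the endpoints are never attained on the piece, so the
        open box and the closed box have the same trace.\<close>
      have "y \<in> C \<longleftrightarrow> y \<in> P k \<and> (\<forall>i\<in>I-J. a i \<le> \<phi> i y \<and> \<phi> i y \<le> b i)" for y
        unfolding C_def using nD a b by (force simp: less_le)
      then have "C = \<Inter>(insert (P k) ((\<lambda>i. P k \<inter> \<phi> i -` {a i..b i}) ` (I - J)))"
        by (auto 0 3)
      moreover have "closedin (top_of_set (P k)) (\<Inter>(insert (P k) ((\<lambda>i. P k \<inter> \<phi> i -` {a i..b i}) ` (I - J))))"
      proof (rule closedin_Inter)
        fix S assume "S \<in> insert (P k) ((\<lambda>i. P k \<inter> \<phi> i -` {a i..b i}) ` (I - J))"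
        then show "closedin (top_of_set (P k)) S"
          using contP by (auto intro!: continuous_closedin_preimage)
      qed simp
      ultimately have cC: "closedin (top_of_set (P k)) C" by simp
      have "x \<in> C" unfolding C_def using x a b by auto
      moreover have "C \<subseteq> W"
      proof
        fix y assume y: "y \<in> C"
        have "\<bar>\<phi> i y - \<phi> i x\<bar> < \<delta>" if "i \<in> I" for i
        proof (cases "i \<in> J")
          case True
          then show ?thesis using x y \<delta>(1) unfolding C_def P_def k by auto
        next
          case False
          then have i: "i \<in> I - J" using that by simp
          then have "a i < \<phi> i y \<and> \<phi> i y < b i" using y unfolding C_def by auto
          then show ?thesis using a[OF i] b[OF i] by (simp add: abs_less_iff)
        qed
        then have "dist y x < e" using y PR RU unfolding C_def by (intro \<delta>(2)) auto
        then show "y \<in> W" using y unfolding C_def by (intro e(2)) auto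
      qed
      ultimately show "\<exists>C. openin (top_of_set (P k)) C \<and> closedin (top_of_set (P k)) C \<and> x \<in> C \<and> C \<subseteq> W"
        using oC cC by blast
    qed
  qed
qed

section \<open>Bounds by the number of coordinates, and one less on hyperplanes\<close>

lemma covering_dim_le_card_coordinates:
  fixes U :: "'a::{metric_space, second_countable_topology} set" and \<phi> :: "'i \<Rightarrow> 'a \<Rightarrow> real"
  assumes fin: "finite I" and cont: "\<And>i. i \<in> I \<Longrightarrow> continuous_on U (\<phi> i)"
    and emb: "\<And>x e. x \<in> U \<Longrightarrow> e > 0 \<Longrightarrow>
      \<exists>\<delta>>0. \<forall>y\<in>U. (\<forall>i\<in>I. \<bar>\<phi> i y - \<phi> i x\<bar> < \<delta>) \<longrightarrow> dist y x < e"
  shows "covering_dim_le (top_of_set U) (card I)"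
proof (rule covering_dim_le_few_coordinates[where \<phi> = \<phi> and D = "\<lambda>_. \<rat>", OF fin cont emb])
  show "countable (\<rat> :: real set)" by (rule countable_rat)
  show "\<exists>q\<in>\<rat>. a < q \<and> q < b" if "a < b" for a b :: real
    using Rats_dense_in_real[OF that] .
  show "card {i\<in>I. \<phi> i x \<in> \<rat>} \<le> card I" for x
    using fin by (intro card_mono) auto
qed

text \<open>The shifts are multiples of one real \<tau> by distinct natural numbers. A forbidden
  relation determines \<tau> as a rational plus an element of \<open>C\<close>, divided by a nonzero
  integer, so only countably many values are bad.\<close>

lemma rational_generic_shifts:
  fixes C :: "real set"
  assumes "finite I" "countable C"
  obtains \<theta> :: "'i \<Rightarrow> real"
    where "\<And>i l c. i \<in> I \<Longrightarrow> l \<in> I \<Longrightarrow> i \<noteq> l \<Longrightarrow> c \<in> C \<Longrightarrow> \<theta> i - \<theta> l - c \<notin> \<rat>"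
proof -
  obtain e :: "'i \<Rightarrow> nat" where e: "inj_on e I"
    using countable_finite[OF assms(1)] unfolding countable_def by blast
  define B where "B = (\<lambda>(m, q, c). (q + c) / m) ` (\<int> \<times> \<rat> \<times> C)"
  have "countable B"
    unfolding B_def using assms(2) countable_rat countable_int by blast
  then obtain \<tau> where \<tau>: "\<tau> \<notin> B"
    using uncountable_UNIV_real by (metis UNIV_I countable_subset subsetI)
  show ?thesis
  proof
    fix i l c assume il: "i \<in> I" "l \<in> I" "i \<noteq> l" and c: "c \<in> C"
    define m where "m = real (e i) - real (e l)"
    have "m \<noteq> 0" unfolding m_def using il e by (auto dest: inj_onD)
    show "\<tau> * real (e i) - \<tau> * real (e l) - c \<notin> \<rat>"
    proof
      assume q: "\<tau> * real (e i) - \<tau> * real (e l) - c \<in> \<rat>"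
      have "\<tau> = ((\<tau> * real (e i) - \<tau> * real (e l) - c) + c) / m"
        using \<open>m \<noteq> 0\<close> unfolding m_def by (simp add: field_simps)
      moreover have "m \<in> \<int>" unfolding m_def by simp
      ultimately have "\<tau> \<in> B" unfolding B_def using q c
        by (intro image_eqI[of _ _ "(m, \<tau> * real (e i) - \<tau> * real (e l) - c, c)"]) auto
      then show False using \<tau> by simp
    qed
  qed
qed

text \<open>
  The classes are taken with respect to \<open>\<theta> i + \<rat>\<close> for generic \<open>\<theta>\<close>, so that no point of a
  hyperplane has all its coordinates in the chosen dense sets: the top class is empty.
\<close>

lemma covering_dim_le_hyperplanes:
  fixes U :: "'a::{metric_space, second_countable_topology} set" and \<phi> :: "'i \<Rightarrow> 'a \<Rightarrow> real"
  assumes fin: "finite I" and cont: "\<And>i. i \<in> I \<Longrightarrow> continuous_on U (\<phi> i)"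
    and emb: "\<And>x e. x \<in> U \<Longrightarrow> e > 0 \<Longrightarrow>
      \<exists>\<delta>>0. \<forall>y\<in>U. (\<forall>i\<in>I. \<bar>\<phi> i y - \<phi> i x\<bar> < \<delta>) \<longrightarrow> dist y x < e"
    and "countable C"
    and hyp: "\<And>x. x \<in> U \<Longrightarrow> \<exists>i\<in>I. \<exists>l\<in>I. i \<noteq> l \<and> \<phi> i x - \<phi> l x \<in> C"
  shows "covering_dim_le (top_of_set U) (card I - 1)"
proof -
  obtain \<theta> :: "'i \<Rightarrow> real" where
    \<theta>: "\<And>i l c. i \<in> I \<Longrightarrow> l \<in> I \<Longrightarrow> i \<noteq> l \<Longrightarrow> c \<in> C \<Longrightarrow> \<theta> i - \<theta> l - c \<notin> \<rat>"
    using rational_generic_shifts[OF fin \<open>countable C\<close>] by blast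
  show ?thesis
  proof (rule covering_dim_le_few_coordinates[where \<phi> = \<phi> and D = "\<lambda>i. (+) (\<theta> i) ` \<rat>", OF fin cont emb])
    show "countable ((+) (\<theta> i) ` \<rat>)" for i
      using countable_rat by (rule countable_image)
    show "\<exists>q\<in>(+) (\<theta> i) ` \<rat>. a < q \<and> q < b" if "a < b" for i a b
    proof -
      have "a - \<theta> i < b - \<theta> i" using that by simp
      then obtain q where "q \<in> \<rat>" "a - \<theta> i < q" "q < b - \<theta> i"
        using Rats_dense_in_real by blast
      then show ?thesis by (intro bexI[of _ "\<theta> i + q"]) auto
    qed
    fix x assume "x \<in> U"
    then obtain i l where il: "i \<in> I" "l \<in> I" "i \<noteq> l" "\<phi> i x - \<phi> l x \<in> C" using hyp by blast
    have "\<not> (\<phi> i x \<in> (+) (\<theta> i) ` \<rat> \<and> \<phi> l x \<in> (+) (\<theta> l) ` \<rat>)"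
    proof
      assume "\<phi> i x \<in> (+) (\<theta> i) ` \<rat> \<and> \<phi> l x \<in> (+) (\<theta> l) ` \<rat>"
      then obtain p q where pq: "p \<in> \<rat>" "q \<in> \<rat>" "\<phi> i x = \<theta> i + p" "\<phi> l x = \<theta> l + q" by auto
      then have "\<theta> i - \<theta> l - (\<phi> i x - \<phi> l x) = q - p" by simp
      then show False using \<theta>[OF il] pq(1,2) by simp
    qed
    then have "{i\<in>I. \<phi> i x \<in> (+) (\<theta> i) ` \<rat>} \<subset> I" using il by blast
    then have "card {i\<in>I. \<phi> i x \<in> (+) (\<theta> i) ` \<rat>} < card I"
      using fin by (rule psubset_card_mono[rotated])
    then show "card {i\<in>I. \<phi> i x \<in> (+) (\<theta> i) ` \<rat>} \<le> card I - 1" by simp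
  qed
qed

section \<open>Covering dimension: the lower bound\<close>

text \<open>
  A partition of unity subordinate to a fine cover of order \<open>d + 1\<close> moves points of the ball by at
  most \<open>1/2\<close>, so by Brouwer it maps onto a smaller ball; but its image lies in finitely many affine
  subspaces of dimension at most \<open>d\<close>.
\<close>

lemma covering_dim_le_ball_subspace:
  fixes L :: "'a::euclidean_space set"
  assumes L: "subspace L" and cov: "covering_dim_le (top_of_set (cball 0 1 \<inter> L)) d"
  shows "dim L \<le> d"
proof (rule ccontr)
  assume "\<not> dim L \<le> d"
  then have dL: "d < dim L" by simp
  define K where "K = cball 0 1 \<inter> L"
  have K: "compact K" "convex K" "0 \<in> K"
    unfolding K_def using L closed_subspace[OF L]
    by (simp_all add: compact_Int_closed convex_Int subspace_imp_convex subspace_0)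
  \<comment> \<open>Radius 1/4 keeps any two points of a cover member within 1/2, the displacement
    allowed to \<open>f\<close>.\<close>
  define \<U> where "\<U> = (\<lambda>c. K \<inter> ball c (1/4)) ` K"
  have "\<forall>U\<in>\<U>. openin (top_of_set K) U" unfolding \<U>_def by (auto intro: openin_open_Int)
  moreover have "\<Union>\<U> = topspace (top_of_set K)" unfolding \<U>_def by auto
  ultimately obtain \<V> where op: "\<forall>V\<in>\<V>. openin (top_of_set K) V" and UV: "\<Union>\<V> = K"
    and ref: "\<forall>V\<in>\<V>. \<exists>U\<in>\<U>. V \<subseteq> U"
    and order: "\<forall>x\<in>K. finite {V\<in>\<V>. x \<in> V} \<and> card {V\<in>\<V>. x \<in> V} \<le> d + 1"
    using cov[unfolded covering_dim_le_def, folded K_def, THEN spec, of \<U>] by auto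
  have "\<forall>V\<in>\<V>. \<exists>W. open W \<and> V = K \<inter> W" using op by (simp add: openin_open)
  then obtain w where w: "\<And>V. V \<in> \<V> \<Longrightarrow> open (w V) \<and> V = K \<inter> w V" by metis
  have covw: "K \<subseteq> \<Union>(w ` \<V>)"
  proof
    fix x assume "x \<in> K"
    then obtain V where "V \<in> \<V>" "x \<in> V" using UV by blast
    then show "x \<in> \<Union>(w ` \<V>)" using w[of V] by blast
  qed
  have opw: "open W" if "W \<in> w ` \<V>" for W using w that by auto
  obtain \<C>' where \<C>': "\<C>' \<subseteq> w ` \<V>" "finite \<C>'" "K \<subseteq> \<Union>\<C>'"
    using compactE[OF K(1) covw opw] by blast
  \<comment> \<open>Sets that miss \<open>K\<close> are dropped so that every member supplies a
    vertex \<open>a W\<close>.\<close>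
  define \<C> where "\<C> = {W\<in>\<C>'. K \<inter> W \<noteq> {}}"
  have fC: "finite \<C>" and covC: "K \<subseteq> \<Union>\<C>" unfolding \<C>_def using \<C>'(2,3) by (simp, blast)
  have CV: "open W \<and> K \<inter> W \<in> \<V> \<and> w (K \<inter> W) = W" if W: "W \<in> \<C>" for W
  proof -
    obtain V where "V \<in> \<V>" "W = w V" using W \<C>'(1) unfolding \<C>_def by auto
    then show ?thesis using w[of V] by simp
  qed
  have "\<forall>W\<in>\<C>. \<exists>y. y \<in> K \<inter> W" unfolding \<C>_def by auto
  then obtain a where a: "\<And>W. W \<in> \<C> \<Longrightarrow> a W \<in> K \<inter> W" by metis
  have near: "dist (a W) x \<le> 1/2" if W: "W \<in> \<C>" "x \<in> K" "x \<in> W" for W x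
  proof -
    have "K \<inter> W \<in> \<V>" using CV[OF W(1)] by simp
    then obtain U where "U \<in> \<U>" "K \<inter> W \<subseteq> U" using ref by auto
    then obtain c where "K \<inter> W \<subseteq> ball c (1/4)" unfolding \<U>_def by auto
    then have "dist c (a W) < 1/4" "dist c x < 1/4" using a[OF W(1)] W by auto
    then show ?thesis using dist_triangle3[of "a W" x c] by simp
  qed
  have fin: "\<exists>V. open V \<and> x \<in> V \<and> finite {U \<in> \<C>. U \<inter> V \<noteq> {}}" for x
    using fC by (intro exI[of _ UNIV]) simp
  have opC: "open W" if "W \<in> \<C>" for W
    using CV[OF that] by simp
  obtain F where F: "\<And>W. W \<in> \<C> \<Longrightarrow> continuous_on K (F W) \<and> (\<forall>x\<in>K. 0 \<le> F W x)"
      "\<And>x W. W \<in> \<C> \<Longrightarrow> x \<in> K \<Longrightarrow> x \<notin> W \<Longrightarrow> F W x = (0::real)"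
      "\<And>x. x \<in> K \<Longrightarrow> supp_sum (\<lambda>W. F W x) \<C> = 1"
  proof (rule subordinate_partition_of_unity[OF covC opC fin])
    fix F :: "'a set \<Rightarrow> 'a \<Rightarrow> real"
    assume F: "\<And>W. W \<in> \<C> \<Longrightarrow> continuous_on K (F W) \<and> (\<forall>x\<in>K. 0 \<le> F W x)"
      "\<And>x W. W \<in> \<C> \<Longrightarrow> x \<in> K \<Longrightarrow> x \<notin> W \<Longrightarrow> F W x = 0"
      "\<And>x. x \<in> K \<Longrightarrow> supp_sum (\<lambda>W. F W x) \<C> = 1"
    show thesis using F by (rule that)
  qed auto
  define E where "E x = {W\<in>\<C>. x \<in> W}" for x
  have fE: "finite (E x)" and EC: "E x \<subseteq> \<C>" for x unfolding E_def using fC by auto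
  have sumE: "(\<Sum>W\<in>\<C>. F W x *\<^sub>R g W) = (\<Sum>W\<in>E x. F W x *\<^sub>R g W)" if "x \<in> K" for x and g :: "'a set \<Rightarrow> 'b::real_vector"
    using fC F(2)[OF _ that] by (intro sum.mono_neutral_right) (auto simp: E_def)
  have sum1: "(\<Sum>W\<in>E x. F W x) = 1" if "x \<in> K" for x
  proof -
    have "(\<Sum>W\<in>E x. F W x) = supp_sum (\<lambda>W. F W x) \<C>"
      unfolding supp_sum_def support_on_def
      using fC F(2)[OF _ that] by (intro sum.mono_neutral_right) (auto simp: E_def)
    then show ?thesis using F(3) that by simp
  qed
  define f where "f x = (\<Sum>W\<in>\<C>. F W x *\<^sub>R a W)" for x
  have inC: "f x \<in> S" if "x \<in> K" "convex S" "a ` E x \<subseteq> S" for x S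
    unfolding f_def sumE[OF that(1)] using that fE sum1[OF that(1)] F(1) EC
    by (intro convex_sum) blast+
  have fK: "f x \<in> K" if "x \<in> K" for x using that K(2) a EC by (intro inC) auto
  have fx: "norm (f x - x) \<le> 1/2" if "x \<in> K" for x
  proof -
    have "x = (\<Sum>W\<in>E x. F W x *\<^sub>R x)"
      using sum1[OF that] by (metis scaleR_left.sum scaleR_one)
    then have "f x - x = (\<Sum>W\<in>E x. F W x *\<^sub>R (a W - x))"
      unfolding f_def sumE[OF that] by (simp add: sum_subtractf scaleR_diff_right)
    also have "norm \<dots> \<le> (\<Sum>W\<in>E x. F W x * (1/2))"
    proof (rule sum_norm_le)
      fix W assume "W \<in> E x"
      then have W: "W \<in> \<C>" "x \<in> W" unfolding E_def by auto
      have "F W x * norm (a W - x) \<le> F W x * (1/2)"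
        using near[OF W(1) that W(2)] F(1)[OF W(1)] that by (intro mult_left_mono) (auto simp: dist_norm)
      then show "norm (F W x *\<^sub>R (a W - x)) \<le> F W x * (1/2)" using F(1)[OF W(1)] that by simp
    qed
    also have "\<dots> = 1/2" using sum1[OF that] unfolding sum_distrib_right[symmetric] by simp
    finally show ?thesis .
  qed
  have contf: "continuous_on K f"
    unfolding f_def using F(1) by (intro continuous_intros) auto
  have surj: "\<exists>x\<in>K. f x = z" if z: "z \<in> L" "norm z \<le> 1/2" for z
  proof -
    \<comment> \<open>A fixed point of \<open>h\<close> is a preimage of \<open>z\<close>; the
      displacement 1/2 and the norm of \<open>z\<close> together keep \<open>h\<close> in the unit
      ball.\<close>
    define h where "h x = x - f x + z" for x
    have "h x \<in> K" if "x \<in> K" for x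
    proof -
      have "norm (h x) \<le> norm (x - f x) + norm z" unfolding h_def by (rule norm_triangle_ineq)
      also have "\<dots> \<le> 1" using fx[OF that] z by (simp add: norm_minus_commute)
      finally show ?thesis
        using that fK[OF that] z L unfolding K_def h_def by (auto intro: subspace_add subspace_diff)
    qed
    moreover have "continuous_on K h" unfolding h_def using contf by (intro continuous_intros)
    ultimately obtain x where "x \<in> K" "h x = x"
      using brouwer[OF K(1,2), of h] K(3) by blast
    then show ?thesis unfolding h_def by (intro bexI[of _ x]) (auto simp: algebra_simps)
  qed
  have cardE: "card (E x) \<le> d + 1" if "x \<in> K" for x
  proof -
    \<comment> \<open>Since \<open>w\<close> recovers a member of \<C> from its trace on
      \<open>K\<close>, the order of \<V> bounds the order of \<C>.\<close>
    have "card (E x) = card ((\<inter>) K ` E x)"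
    proof (rule card_image[symmetric], rule inj_onI)
      fix W W' assume "W \<in> E x" "W' \<in> E x" "K \<inter> W = K \<inter> W'"
      then have "W \<in> \<C>" "W' \<in> \<C>" "w (K \<inter> W) = w (K \<inter> W')" using EC by auto
      then show "W = W'" using CV by simp
    qed
    also have "\<dots> \<le> card {V\<in>\<V>. x \<in> V}"
      using order that CV EC by (intro card_mono) (auto simp: E_def)
    finally show ?thesis using order that by fastforce
  qed
  \<comment> \<open>A value of \<open>f\<close> lies in the hull of at most \<open>d + 1\<close>
    vertices. Each such hull has dimension at most \<open>d < dim L\<close>, and finitely many of
    them leave points of \<open>L\<close> arbitrarily close to 0 uncovered.\<close>
  define \<A> where "\<A> = (\<lambda>D. affine hull (a ` D)) ` {D\<in>Pow \<C>. card D \<le> d + 1}"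
  have fA: "finite \<A>" unfolding \<A>_def using fC by simp
  have "L \<subseteq> closure (\<Inter>((\<lambda>A. L - A) ` \<A>))"
  proof (rule Baire)
    show "closed L" by (rule closed_subspace[OF L])
    show "countable ((\<lambda>A. L - A) ` \<A>)" using fA by (simp add: countable_finite)
    fix T assume "T \<in> (\<lambda>A. L - A) ` \<A>"
    then obtain D where D: "D \<subseteq> \<C>" "card D \<le> d + 1" "T = L - affine hull (a ` D)"
      unfolding \<A>_def by auto
    have fD: "finite D" using D(1) fC by (rule finite_subset)
    have "aff_dim (affine hull (a ` D)) \<le> int (card (a ` D)) - 1"
      using aff_dim_le_card[of "a ` D"] fD by (simp add: aff_dim_affine_hull)
    also have "\<dots> \<le> d" using card_image_le[OF fD, of a] D(2) by linarith
    also have "\<dots> < aff_dim L" using dL by (simp add: aff_dim_subspace[OF L])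
    finally have "closure (L - affine hull (a ` D)) = L"
      using L by (intro dense_complement_affine) (auto intro: subspace_imp_affine)
    moreover have "openin (top_of_set L) (L - affine hull (a ` D))"
      unfolding Diff_eq by (intro openin_open_Int) auto
    ultimately show "openin (top_of_set L) T \<and> L \<subseteq> closure T" using D(3) by simp
  qed
  then have "0 \<in> closure (\<Inter>((\<lambda>A. L - A) ` \<A>))" using subspace_0[OF L] by (rule subsetD)
  then have "\<forall>e>0. \<exists>z\<in>\<Inter>((\<lambda>A. L - A) ` \<A>). dist z 0 < e"
    by (simp only: closure_approachable)
  from this[rule_format, of "1/2"] have "\<exists>z\<in>\<Inter>((\<lambda>A. L - A) ` \<A>). dist z 0 < 1/2"
    by (simp only: half_gt_zero zero_less_one)
  then obtain z where z: "z \<in> \<Inter>((\<lambda>A. L - A) ` \<A>)" "dist z 0 < 1/2" ..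
  \<comment> \<open>The empty set of vertices makes \<A> non-empty; otherwise the intersection would
    not be confined to \<open>L\<close>.\<close>
  have "affine hull (a ` {}) \<in> \<A>" unfolding \<A>_def by (intro image_eqI[of _ _ "{}"]) auto
  then have "z \<in> L" using z(1) by blast
  then obtain x where x: "x \<in> K" "f x = z" using surj[of z] z(2) by auto
  have "f x \<in> affine hull (a ` E x)"
    using x(1) by (intro inC affine_imp_convex) (auto simp: hull_inc)
  moreover have "affine hull (a ` E x) \<in> \<A>"
    unfolding \<A>_def using EC cardE[OF x(1)] by auto
  ultimately show False using z(1) x(2) by blast
qed

text \<open>The image of \<open>K\<close> is closed in \<open>U\<close>, so a cover of
  \<open>K\<close> extends to one of \<open>U\<close> by adding the complement of that image, and a
  refinement pulls back. Compactness also makes images of closed sets closed, so each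
  \<open>W\<close> is the trace of the complement of the image of \<open>K - W\<close>.\<close>

lemma covering_dim_le_compact_embedding:
  fixes h :: "'a::topological_space \<Rightarrow> 'b::t2_space"
  assumes cov: "covering_dim_le (top_of_set U) d"
    and K: "compact K" "continuous_on K h" "inj_on h K" "h ` K \<subseteq> U"
  shows "covering_dim_le (top_of_set K) d"
  unfolding covering_dim_le_def topspace_euclidean_subtopology
proof (intro allI impI; elim conjE)
  fix \<O> assume op: "\<forall>W\<in>\<O>. openin (top_of_set K) W" and covK: "\<Union>\<O> = K"
  define \<W> where "\<W> = insert (U - h ` K) ((\<lambda>W. U - h ` (K - W)) ` \<O>)"
  have cl: "openin (top_of_set U) (U - h ` C)" if "closedin (top_of_set K) C" for C
  proof -
    have "compact C" using that K(1) by (metis closedin_compact)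
    then have "compact (h ` C)"
      using that K(2) closedin_imp_subset by (metis compact_continuous_image continuous_on_subset)
    then show ?thesis unfolding Diff_eq by (intro openin_open_Int) (auto intro: compact_imp_closed)
  qed
  have "openin (top_of_set U) W" if W: "W \<in> \<W>" for W
  proof -
    have "closedin (top_of_set K) (K - W')" if "W' \<in> \<O>" for W'
      using closedin_diff[OF closedin_topspace, of "top_of_set K" W'] op that by simp
    moreover have "closedin (top_of_set K) K" by simp
    ultimately show ?thesis using W cl unfolding \<W>_def by blast
  qed
  moreover have "\<Union>\<W> = U"
  proof
    show "\<Union>\<W> \<subseteq> U" unfolding \<W>_def by auto
    show "U \<subseteq> \<Union>\<W>"
    proof
      fix u assume u: "u \<in> U"
      show "u \<in> \<Union>\<W>"
      proof (cases "u \<in> h ` K")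
        case True
        then obtain x where x: "x \<in> K" "u = h x" by auto
        then obtain W where W: "W \<in> \<O>" "x \<in> W" using covK by auto
        have "u \<notin> h ` (K - W)" using x W K(3) by (auto dest: inj_onD)
        then show ?thesis unfolding \<W>_def using u W by auto
      next
        case False
        then show ?thesis unfolding \<W>_def using u by auto
      qed
    qed
  qed
  ultimately obtain \<V> where V: "\<forall>V\<in>\<V>. openin (top_of_set U) V" "\<Union>\<V> = U"
      "\<forall>V\<in>\<V>. \<exists>W\<in>\<W>. V \<subseteq> W"
      "\<forall>x\<in>U. finite {V\<in>\<V>. x \<in> V} \<and> card {V\<in>\<V>. x \<in> V} \<le> d + 1"
    using cov[unfolded covering_dim_le_def, THEN spec, of \<W>] by auto
  \<comment> \<open>Members that miss the image of \<open>K\<close> may refine only its complement,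
    which comes from no member of \<O>; they are dropped.\<close>
  define \<V>' where "\<V>' = (\<lambda>V. K \<inter> h -` V) ` {V\<in>\<V>. V \<inter> h ` K \<noteq> {}}"
  show "\<exists>\<V>. (\<forall>V\<in>\<V>. openin (top_of_set K) V) \<and> \<Union>\<V> = K \<and> (\<forall>V\<in>\<V>. \<exists>U\<in>\<O>. V \<subseteq> U) \<and>
      (\<forall>x\<in>K. finite {V\<in>\<V>. x \<in> V} \<and> card {V\<in>\<V>. x \<in> V} \<le> d + 1)"
  proof (intro exI[of _ \<V>'] conjI ballI)
    fix V' assume "V' \<in> \<V>'"
    then obtain V where V': "V \<in> \<V>" "V \<inter> h ` K \<noteq> {}" "V' = K \<inter> h -` V" unfolding \<V>'_def by auto
    show "openin (top_of_set K) V'"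
      unfolding V'(3) using K V(1) V'(1) by (intro continuous_openin_preimage[of K h U]) auto
    obtain W where "W \<in> \<W>" "V \<subseteq> W" using V(3) V'(1) by auto
    then obtain W' where "W' \<in> \<O>" "V \<subseteq> U - h ` (K - W')" using V'(2) unfolding \<W>_def by auto
    then show "\<exists>U\<in>\<O>. V' \<subseteq> U" unfolding V'(3) by (intro bexI[of _ W']) auto
  next
    show "\<Union>\<V>' = K"
    proof
      show "\<Union>\<V>' \<subseteq> K" unfolding \<V>'_def by auto
      show "K \<subseteq> \<Union>\<V>'"
      proof
        fix x assume x: "x \<in> K"
        then obtain V where "V \<in> \<V>" "h x \<in> V" using K(4) V(2) by blast
        then show "x \<in> \<Union>\<V>'" unfolding \<V>'_def using x by blast
      qed
    qed
  next
    fix x assume x: "x \<in> K"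
    have sub: "{V'\<in>\<V>'. x \<in> V'} \<subseteq> (\<lambda>V. K \<inter> h -` V) ` {V\<in>\<V>. h x \<in> V}" unfolding \<V>'_def by auto
    have fin: "finite {V\<in>\<V>. h x \<in> V}" "card {V\<in>\<V>. h x \<in> V} \<le> d + 1" using V(4) x K(4) by auto
    show "finite {V'\<in>\<V>'. x \<in> V'}" using sub fin(1) by (rule finite_surj[rotated])
    show "card {V'\<in>\<V>'. x \<in> V'} \<le> d + 1" using surj_card_le[OF fin(1) sub] fin(2) by simp
  qed
qed

section \<open>Residuals, functionals and combinations\<close>

definition ft_residual :: "real ^ 'n \<Rightarrow> real ^ 'n \<Rightarrow> real" where
  "ft_residual s u = Min (range (\<lambda>i. u $ i - s $ i))"

definition ft_coresidual :: "real ^ 'n \<Rightarrow> real ^ 'n \<Rightarrow> real" where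
  "ft_coresidual t u = Max (range (\<lambda>i. u $ i - t $ i))"

text \<open>With no scalar at minus infinity an empty combination has no sensible value: the formula
  is meaningful only for finite non-empty \<open>S\<close>.\<close>

definition ft_comb :: "(real ^ 'n \<Rightarrow> real) \<Rightarrow> (real ^ 'n) set \<Rightarrow> real ^ 'n" where
  "ft_comb a S = (\<chi> i. Max ((\<lambda>s. a s + s $ i) ` S))"

definition ft_functional :: "(real ^ 'n) set \<Rightarrow> (real ^ 'n \<Rightarrow> real) \<Rightarrow> bool" where
  "ft_functional X q \<longleftrightarrow> (\<forall>x\<in>X. \<forall>y\<in>X. q (sup x y) = max (q x) (q y)) \<and>
     (\<forall>a. \<forall>x\<in>X. q (ft_scale a x) = a + q x)"

section \<open>Adjunctions and Lipschitz continuity of functionals\<close>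

lemma ft_scale_nth [simp]: "ft_scale a x $ i = a + x $ i"
  by (simp add: ft_scale_def)

lemma sup_vec_nth [simp]: "sup x y $ i = max (x $ i) (y $ i)" for x y :: "real ^ 'n"
  by (simp add: sup_vec_def sup_max)

lemma ft_scale_ft_scale [simp]: "ft_scale a (ft_scale b x) = ft_scale (a + b) x"
  by (simp add: vec_eq_iff)

lemma ft_scale_0 [simp]: "ft_scale 0 x = x"
  by (simp add: vec_eq_iff)

lemma ft_scale_le_iff: "ft_scale a s \<le> u \<longleftrightarrow> a \<le> ft_residual s u"
  unfolding less_eq_vec_def ft_residual_def by (auto simp: le_diff_eq)

lemma le_ft_scale_iff: "u \<le> ft_scale a t \<longleftrightarrow> ft_coresidual t u \<le> a"
  unfolding less_eq_vec_def ft_coresidual_def by (auto simp: diff_le_eq)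

lemma ft_scale_residual_le: "ft_scale (ft_residual s u) s \<le> u"
  by (simp add: ft_scale_le_iff)

lemma le_ft_scale_coresidual: "u \<le> ft_scale (ft_coresidual t u) t"
  by (simp add: le_ft_scale_iff)

lemma ft_coresidual_self [simp]: "ft_coresidual t t = 0"
  by (simp add: ft_coresidual_def)

text \<open>By \<open>le_ft_scale_iff\<close> the coresidual is the lower adjoint of scaling
  \<open>t\<close>, and lower adjoints preserve suprema. The residual is an upper adjoint; it
  preserves minima and in general is no functional.\<close>

lemma ft_coresidual_ft_functional: "ft_functional X (ft_coresidual t)"
proof -
  have "ft_coresidual t (sup x y) = max (ft_coresidual t x) (ft_coresidual t y)" for x y
  proof (rule antisym)
    have "z \<le> ft_scale (max (ft_coresidual t x) (ft_coresidual t y)) t" if "z \<in> {x, y}" for z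
      using that by (auto simp: le_ft_scale_iff)
    then show "ft_coresidual t (sup x y) \<le> max (ft_coresidual t x) (ft_coresidual t y)"
      unfolding le_ft_scale_iff[symmetric] by simp
    have "x \<le> ft_scale (ft_coresidual t (sup x y)) t" "y \<le> ft_scale (ft_coresidual t (sup x y)) t"
      using le_ft_scale_coresidual[of "sup x y" t] unfolding less_eq_vec_def by auto
    then show "max (ft_coresidual t x) (ft_coresidual t y) \<le> ft_coresidual t (sup x y)"
      by (simp add: le_ft_scale_iff)
  qed
  moreover have "ft_coresidual t (ft_scale a x) = a + ft_coresidual t x" for a x
  proof (rule antisym)
    show "ft_coresidual t (ft_scale a x) \<le> a + ft_coresidual t x"
      using le_ft_scale_coresidual[of x t]
      unfolding le_ft_scale_iff[symmetric] less_eq_vec_def by auto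
    have "x \<le> ft_scale (ft_coresidual t (ft_scale a x) - a) t"
      using le_ft_scale_coresidual[of "ft_scale a x" t] unfolding less_eq_vec_def
      by (auto simp: algebra_simps)
    then show "a + ft_coresidual t x \<le> ft_coresidual t (ft_scale a x)"
      by (simp add: le_ft_scale_iff)
  qed
  ultimately show ?thesis by (simp add: ft_functional_def)
qed

lemma ft_functional_le_add:
  assumes X: "ft_submodule X" and q: "ft_functional X q" and xy: "x \<in> X" "y \<in> X"
    and le: "x \<le> ft_scale a y"
  shows "q x \<le> a + q y"
proof -
  have a: "ft_scale a y \<in> X" using X xy by (auto simp: ft_submodule_def)
  have "sup x (ft_scale a y) = ft_scale a y" using le by (rule sup.absorb2)
  then have "max (q x) (q (ft_scale a y)) = q (ft_scale a y)"
    using q xy(1) a unfolding ft_functional_def by metis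
  then show ?thesis using q xy(2) unfolding ft_functional_def by (simp add: max_def split: if_splits)
qed

lemma ft_functional_mono:
  assumes "ft_submodule X" "ft_functional X q" "x \<in> X" "y \<in> X" "x \<le> y"
  shows "q x \<le> q y"
  using ft_functional_le_add[OF assms(1-4), of 0] assms(5) by simp

lemma le_ft_scale_dist: "x \<le> ft_scale (dist x y) y" for x y :: "real ^ 'n"
proof -
  have "x $ i - y $ i \<le> dist x y" for i
    using component_le_norm_cart[of "x - y" i] by (simp add: dist_norm)
  then show ?thesis unfolding less_eq_vec_def by (auto simp: algebra_simps)
qed

text \<open>A monotone homogeneous map changes by at most \<open>a\<close> when its argument moves
  by at most \<open>a\<close> in every coordinate.\<close>

lemma ft_functional_lipschitz:
  assumes "ft_submodule X" "ft_functional X q" "x \<in> X" "y \<in> X"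
  shows "\<bar>q x - q y\<bar> \<le> dist x y"
  using ft_functional_le_add[OF assms(1,2) assms(3,4) le_ft_scale_dist]
    ft_functional_le_add[OF assms(1,2) assms(4,3) le_ft_scale_dist]
  by (simp add: dist_commute)

lemma ft_functional_continuous_on:
  assumes "ft_submodule X" "ft_functional X q"
  shows "continuous_on X q"
  unfolding continuous_on_iff
proof (intro ballI allI impI)
  fix x e assume x: "x \<in> X" and e: "(0::real) < e"
  have "dist (q y) (q x) < e" if "y \<in> X" "dist y x < e" for y
    using ft_functional_lipschitz[OF assms that(1) x] that(2) by (simp add: dist_real_def)
  then show "\<exists>d>0. \<forall>y\<in>X. dist y x < d \<longrightarrow> dist (q y) (q x) < e"
    using e by blast
qed

text \<open>
  Functionals that reflect the order are coordinates: by homogeneity their values determine a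
  point up to the same sup-norm error.
\<close>

lemma ft_functionals_embedding:
  fixes X :: "(real ^ 'n) set"
  assumes X: "ft_submodule X" and T: "\<And>t. t \<in> T \<Longrightarrow> ft_functional X (q t)"
    and reflect: "\<And>x y. x \<in> X \<Longrightarrow> y \<in> X \<Longrightarrow> (\<forall>t\<in>T. q t x \<le> q t y) \<Longrightarrow> x \<le> y"
    and "e > 0"
  obtains \<delta> where "\<delta> > 0"
    "\<And>x y. x \<in> X \<Longrightarrow> y \<in> X \<Longrightarrow> (\<forall>t\<in>T. \<bar>q t y - q t x\<bar> \<le> \<delta>) \<Longrightarrow> dist y x < e"
proof
  \<comment> \<open>A sup-norm error \<delta> becomes at most \<open>CARD('n)\<close> times \<delta>
    in the l1 norm, which is e/2 and so strictly below \<open>e\<close>.\<close>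
  define \<delta> where "\<delta> = e / (2 * real CARD('n))"
  show "\<delta> > 0" unfolding \<delta>_def using \<open>e > 0\<close> by simp
  fix x y assume xy: "x \<in> X" "y \<in> X" and q: "\<forall>t\<in>T. \<bar>q t y - q t x\<bar> \<le> \<delta>"
  have le: "u \<le> ft_scale \<delta> v" if "u \<in> X" "v \<in> X" "\<forall>t\<in>T. q t u \<le> \<delta> + q t v" for u v
  proof (rule reflect)
    show v: "ft_scale \<delta> v \<in> X" using X that by (auto simp: ft_submodule_def)
    show "\<forall>t\<in>T. q t u \<le> q t (ft_scale \<delta> v)" using T that by (simp add: ft_functional_def)
  qed (rule that)
  have "y \<le> ft_scale \<delta> x" "x \<le> ft_scale \<delta> y"
    using q by (auto intro!: le xy simp: abs_le_iff algebra_simps)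
  then have "\<bar>(y - x) $ i\<bar> \<le> \<delta>" for i
    unfolding less_eq_vec_def by (auto simp: abs_le_iff algebra_simps)
  then have "(\<Sum>i\<in>UNIV. \<bar>(y - x) $ i\<bar>) \<le> (\<Sum>i\<in>(UNIV::'n set). \<delta>)" by (intro sum_mono)
  also have "\<dots> = e / 2" unfolding \<delta>_def by simp
  finally show "dist y x < e"
    using norm_le_l1_cart[of "y - x"] \<open>e > 0\<close> by (simp add: dist_norm)
qed

section \<open>Tropical combinations and generated submodules\<close>

lemma ft_comb_le_iff:
  assumes "finite S" "S \<noteq> {}"
  shows "ft_comb a S \<le> u \<longleftrightarrow> (\<forall>s\<in>S. ft_scale (a s) s \<le> u)"
  using assms unfolding less_eq_vec_def ft_comb_def by auto

lemma ft_comb_nth_ge: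
  assumes "finite S" "s \<in> S"
  shows "a s + s $ i \<le> ft_comb a S $ i"
  unfolding ft_comb_def using assms by simp

lemma ft_comb_nth_attained:
  assumes "finite S" "S \<noteq> {}"
  obtains s where "s \<in> S" "ft_comb a S $ i = a s + s $ i"
proof -
  have "ft_comb a S $ i \<in> (\<lambda>s. a s + s $ i) ` S"
    unfolding ft_comb_def using assms by simp
  then show ?thesis using that by auto
qed

lemma ft_comb_mono:
  assumes "finite S" "S \<noteq> {}" "\<And>s. s \<in> S \<Longrightarrow> a s \<le> b s"
  shows "ft_comb a S \<le> ft_comb b S"
proof -
  have "ft_scale (a s) s \<le> ft_comb b S" if "s \<in> S" for s
    unfolding less_eq_vec_def
  proof
    show "ft_scale (a s) s $ i \<le> ft_comb b S $ i" for i
      using ft_comb_nth_ge[OF assms(1) that, of b i] assms(3)[OF that] by simp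
  qed
  then show ?thesis using ft_comb_le_iff[OF assms(1,2)] by blast
qed

lemma ft_comb_cong: "(\<And>s. s \<in> S \<Longrightarrow> a s = b s) \<Longrightarrow> ft_comb a S = ft_comb b S"
  unfolding ft_comb_def by (simp cong: image_cong_simp)

lemma ft_comb_singleton: "ft_comb a {s} = ft_scale (a s) s"
  by (simp add: vec_eq_iff ft_comb_def)

lemma ft_comb_insert:
  assumes "finite S" "S \<noteq> {}"
  shows "ft_comb a (insert s S) = sup (ft_scale (a s) s) (ft_comb a S)"
  using assms by (simp add: vec_eq_iff ft_comb_def)

lemma ft_comb_sup:
  assumes "finite S" "S \<noteq> {}"
  shows "ft_comb (\<lambda>s. max (a s) (b s)) S = sup (ft_comb a S) (ft_comb b S)"
  using assms
proof (induction rule: finite_ne_induct)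
  case (insert s S)
  then show ?case by (simp add: ft_comb_insert) (simp add: vec_eq_iff max_add_distrib_left max.assoc max.left_commute)
qed (simp add: ft_comb_singleton vec_eq_iff max_add_distrib_left)

lemma ft_comb_scale:
  assumes "finite S" "S \<noteq> {}"
  shows "ft_comb (\<lambda>s. c + a s) S = ft_scale c (ft_comb a S)"
  using assms
proof (induction rule: finite_ne_induct)
  case (insert s S)
  then show ?case by (simp add: ft_comb_insert) (simp add: vec_eq_iff max_add_distrib_right add.assoc)
qed (simp add: ft_comb_singleton vec_eq_iff)

lemma ft_comb_in:
  assumes "finite S" "S \<noteq> {}" "S \<subseteq> X" "ft_submodule X"
  shows "ft_comb a S \<in> X"
  using assms
proof (induction rule: finite_ne_induct)
  case (insert s S)
  then show ?case by (simp add: ft_comb_insert ft_submodule_def)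
qed (simp add: ft_comb_singleton ft_submodule_def)

lemma ft_functional_comb:
  assumes "finite S" "S \<noteq> {}" "S \<subseteq> X" "ft_submodule X" "ft_functional X q"
  shows "q (ft_comb a S) = Max ((\<lambda>s. a s + q s) ` S)"
  using assms
proof (induction rule: finite_ne_induct)
  case (insert s S)
  have "q (ft_comb a (insert s S)) = max (q (ft_scale (a s) s)) (q (ft_comb a S))"
    using insert ft_comb_in[OF insert(1,2), of X a]
    by (simp add: ft_comb_insert ft_submodule_def ft_functional_def)
  then show ?case using insert by (simp add: ft_functional_def)
qed (simp add: ft_comb_singleton ft_functional_def)

lemma ft_submodule_hull: "ft_submodule (ft_submodule hull S)"
  by (rule hull_in) (fastforce simp: ft_submodule_def)

text \<open>Residuals are the largest coefficients that keep the combination below \<open>x\<close>.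
  \<open>P\<close> says that they also reach \<open>x\<close> in every coordinate; generators have
  this property, and suprema and translates inherit it.\<close>

lemma ft_submodule_hull_comb:
  assumes "finite S" "x \<in> ft_submodule hull S"
  shows "x = ft_comb (\<lambda>s. ft_residual s x) S"
proof -
  define P where "P x \<longleftrightarrow> (\<forall>i. \<exists>s\<in>S. x $ i \<le> ft_residual s x + s $ i)" for x
  have mono: "ft_residual s x \<le> ft_residual s y" if "x \<le> y" for s x y
    using ft_scale_residual_le[of s x] that by (metis ft_scale_le_iff order_trans)
  have res_scale: "a + ft_residual s x \<le> ft_residual s (ft_scale a x)" for a s x
    using ft_scale_residual_le[of s x] unfolding ft_scale_le_iff[symmetric] less_eq_vec_def by auto
  have "P x"
    using assms(2)
  proof (rule hull_induct)
    fix s assume s: "s \<in> S"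
    have "0 \<le> ft_residual s s" by (simp flip: ft_scale_le_iff)
    then show "P s" unfolding P_def using s by force
  next
    have "P (sup x y)" if P: "P x" "P y" for x y
      unfolding P_def
    proof
      fix i
      obtain z where z0: "z \<in> {x, y}" "sup x y $ i = z $ i"
        by (cases "x $ i \<le> y $ i") auto
      then obtain s where z: "z \<in> {x, y}" "sup x y $ i = z $ i" "s \<in> S" "z $ i \<le> ft_residual s z + s $ i"
        using P unfolding P_def by blast
      have "z \<le> sup x y" using z(1) by auto
      then show "\<exists>s\<in>S. sup x y $ i \<le> ft_residual s (sup x y) + s $ i"
        using z(2-) mono[of z "sup x y" s] by (intro bexI[of _ s]) auto
    qed
    moreover have "P (ft_scale a x)" if "P x" for a x
      unfolding P_def ft_scale_nth
    proof
      fix i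
      obtain s where "s \<in> S" "x $ i \<le> ft_residual s x + s $ i" using \<open>P x\<close> unfolding P_def by blast
      then show "\<exists>s\<in>S. a + x $ i \<le> ft_residual s (ft_scale a x) + s $ i"
        using res_scale[of a s x] by (intro bexI[of _ s]) auto
    qed
    ultimately show "ft_submodule {x. P x}" by (simp add: ft_submodule_def)
  qed
  then have "S \<noteq> {}" unfolding P_def by auto
  show ?thesis
  proof (rule antisym)
    show "x \<le> ft_comb (\<lambda>s. ft_residual s x) S"
      unfolding less_eq_vec_def
    proof
      fix i
      obtain s where "s \<in> S" "x $ i \<le> ft_residual s x + s $ i" using \<open>P x\<close> unfolding P_def by blast
      then show "x $ i \<le> ft_comb (\<lambda>s. ft_residual s x) S $ i"
        using ft_comb_nth_ge[OF assms(1), of s "\<lambda>s. ft_residual s x" i] by simp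
    qed
    show "ft_comb (\<lambda>s. ft_residual s x) S \<le> x"
      using assms(1) \<open>S \<noteq> {}\<close> by (simp add: ft_comb_le_iff ft_scale_residual_le)
  qed
qed

section \<open>Projectivity and dual bases\<close>

text \<open>The value on the empty list is arbitrary: the modules have no zero element.\<close>

fun ft_sum :: "'b ft_struct \<Rightarrow> ('s \<Rightarrow> 'b) \<Rightarrow> 's list \<Rightarrow> 'b" where
  "ft_sum M f [] = undefined"
| "ft_sum M f [s] = f s"
| "ft_sum M f (s # t # ss) = ft_add M (f s) (ft_sum M f (t # ss))"

lemma ft_sum_Cons: "xs \<noteq> [] \<Longrightarrow> ft_sum M f (s # xs) = ft_add M (f s) (ft_sum M f xs)"
  by (cases xs) auto

context ft_module
begin

lemma ft_sum_closed:
  assumes "xs \<noteq> []" "\<And>s. s \<in> set xs \<Longrightarrow> f s \<in> ft_carrier M"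
  shows "ft_sum M f xs \<in> ft_carrier M"
  using assms by (induction xs rule: list_nonempty_induct) (auto simp: ft_sum_Cons add_closed)

lemma add_add_swap:
  assumes "a \<in> ft_carrier M" "b \<in> ft_carrier M" "c \<in> ft_carrier M" "d \<in> ft_carrier M"
  shows "ft_add M (ft_add M a b) (ft_add M c d) = ft_add M (ft_add M a c) (ft_add M b d)"
proof -
  have "ft_add M (ft_add M a b) (ft_add M c d) = ft_add M a (ft_add M (ft_add M b c) d)"
    using assms by (simp add: add_assoc add_closed)
  also have "\<dots> = ft_add M a (ft_add M (ft_add M c b) d)"
    using assms by (simp add: add_commute)
  also have "\<dots> = ft_add M (ft_add M a c) (ft_add M b d)"
    using assms by (simp add: add_assoc add_closed)
  finally show ?thesis .
qed

lemma ft_sum_add: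
  assumes "xs \<noteq> []" "\<And>s. s \<in> set xs \<Longrightarrow> f s \<in> ft_carrier M" "\<And>s. s \<in> set xs \<Longrightarrow> g s \<in> ft_carrier M"
  shows "ft_sum M (\<lambda>s. ft_add M (f s) (g s)) xs = ft_add M (ft_sum M f xs) (ft_sum M g xs)"
  using assms
proof (induction xs rule: list_nonempty_induct)
  case (cons x xs)
  have "ft_sum M f xs \<in> ft_carrier M" "ft_sum M g xs \<in> ft_carrier M"
    using cons by (auto intro!: ft_sum_closed)
  then show ?case using cons by (simp add: ft_sum_Cons add_add_swap)
qed simp

lemma ft_sum_smult:
  assumes "xs \<noteq> []" "\<And>s. s \<in> set xs \<Longrightarrow> f s \<in> ft_carrier M"
  shows "ft_sum M (\<lambda>s. ft_smult M a (f s)) xs = ft_smult M a (ft_sum M f xs)"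
  using assms
proof (induction xs rule: list_nonempty_induct)
  case (cons x xs)
  have "ft_sum M f xs \<in> ft_carrier M" using cons by (auto intro!: ft_sum_closed)
  then show ?case using cons by (simp add: ft_sum_Cons smult_add)
qed simp

lemma ft_hom_sum:
  assumes "h \<in> ft_hom M N" "xs \<noteq> []" "\<And>s. s \<in> set xs \<Longrightarrow> f s \<in> ft_carrier M"
  shows "h (ft_sum M f xs) = ft_sum N (\<lambda>s. h (f s)) xs"
  using assms(2,3)
proof (induction xs rule: list_nonempty_induct)
  case (cons x xs)
  have "ft_sum M f xs \<in> ft_carrier M" using cons by (auto intro!: ft_sum_closed)
  then show ?case using cons assms(1) by (simp add: ft_sum_Cons ft_hom_def)
qed simp

end

lemma ft_sum_ft_of:
  assumes "xs \<noteq> []"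
  shows "ft_sum (ft_of X) (\<lambda>s. ft_scale (a s) s) xs = ft_comb a (set xs)"
  using assms
proof (induction xs rule: list_nonempty_induct)
  case (cons x xs)
  then show ?case by (simp add: ft_sum_Cons ft_comb_insert) (simp add: ft_of_def)
qed (simp add: ft_comb_singleton)

lemma ft_of_simps [simp]:
  "ft_carrier (ft_of X) = X" "ft_add (ft_of X) = sup" "ft_smult (ft_of X) = ft_scale"
  by (simp_all add: ft_of_def)

text \<open>
  A morphism is lifted by choosing preimages of the images of the generators; the functionals
  \<open>c s\<close> make the lift well defined.
\<close>

lemma ft_projective_if_dual_basis:
  fixes X :: "(real ^ 'n) set"
  assumes X: "ft_submodule X" and S: "finite S" "S \<noteq> {}" "S \<subseteq> X"
    and c: "\<And>s. s \<in> S \<Longrightarrow> ft_functional X (c s)"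
    and eq: "\<And>x. x \<in> X \<Longrightarrow> x = ft_comb (\<lambda>s. c s x) S"
  shows "ft_projective TYPE('u) (ft_of X)"
  unfolding ft_projective_def
proof (intro conjI allI impI; (elim conjE)?)
  show mX: "ft_module (ft_of X)" using X by (rule ft_module_ft_of)
  fix A M :: "'u ft_struct" and f g
  assume A: "ft_module A" and M: "ft_module M" and g: "g \<in> ft_hom (ft_of X) M"
    and f: "f \<in> ft_hom A M" "f ` ft_carrier A = ft_carrier M"
  interpret X: ft_module "ft_of X" by (rule mX)
  interpret A: ft_module A by (rule A)
  interpret M: ft_module M by (rule M)
  obtain xs where xs: "set xs = S" using finite_list[OF S(1)] by blast
  then have ne: "xs \<noteq> []" using S(2) by auto
  have "\<forall>s\<in>S. \<exists>a. a \<in> ft_carrier A \<and> f a = g s"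
  proof
    fix s assume "s \<in> S"
    then have "s \<in> X" using S(3) by blast
    then have "g s \<in> f ` ft_carrier A" unfolding f(2) using g by (auto simp: ft_hom_def)
    then show "\<exists>a. a \<in> ft_carrier A \<and> f a = g s" by auto
  qed
  then obtain \<alpha> where \<alpha>: "\<And>s. s \<in> S \<Longrightarrow> \<alpha> s \<in> ft_carrier A \<and> f (\<alpha> s) = g s" by metis
  define p where "p x = ft_sum A (\<lambda>s. ft_smult A (c s x) (\<alpha> s)) xs" for x
  have cl: "ft_smult A r (\<alpha> s) \<in> ft_carrier A" if "s \<in> set xs" for r s
    using that \<alpha> xs by (simp add: A.smult_closed)
  have cong: "ft_sum N F xs = ft_sum N G xs" if "\<And>s. s \<in> S \<Longrightarrow> F s = G s" for N :: "'u ft_struct" and F G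
    using ne xs that
  proof (induction xs arbitrary: S rule: list_nonempty_induct)
    case (cons x xs)
    have "ft_sum N F xs = ft_sum N G xs" using cons.IH[of "set xs"] cons.prems by auto
    then show ?case using cons by (auto simp: ft_sum_Cons)
  qed auto
  show "\<exists>p\<in>ft_hom (ft_of X) A. \<forall>x\<in>ft_carrier (ft_of X). f (p x) = g x"
  proof (intro bexI[of _ p] ballI)
    show "p \<in> ft_hom (ft_of X) A"
      unfolding ft_hom_def mem_Collect_eq ft_of_simps
    proof (intro conjI ballI allI)
      show "p ` X \<subseteq> ft_carrier A" unfolding p_def using ne cl by (auto intro!: A.ft_sum_closed)
      show "p (sup x y) = ft_add A (p x) (p y)" if "x \<in> X" "y \<in> X" for x y
      proof -
        have "p (sup x y) = ft_sum A (\<lambda>s. ft_add A (ft_smult A (c s x) (\<alpha> s)) (ft_smult A (c s y) (\<alpha> s))) xs"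
          unfolding p_def using that c \<alpha> by (intro cong) (simp add: ft_functional_def A.max_smult)
        then show ?thesis unfolding p_def using A.ft_sum_add[OF ne cl cl] by simp
      qed
      show "p (ft_scale a x) = ft_smult A a (p x)" if "x \<in> X" for a x
      proof -
        have "p (ft_scale a x) = ft_sum A (\<lambda>s. ft_smult A a (ft_smult A (c s x) (\<alpha> s))) xs"
          unfolding p_def using that c \<alpha> by (intro cong) (simp add: ft_functional_def A.smult_smult)
        then show ?thesis unfolding p_def using A.ft_sum_smult[OF ne cl] by simp
      qed
    qed
    fix x assume "x \<in> ft_carrier (ft_of X)"
    then have x: "x \<in> X" by simp
    have "f (p x) = ft_sum M (\<lambda>s. f (ft_smult A (c s x) (\<alpha> s))) xs"
      unfolding p_def by (rule A.ft_hom_sum[OF f(1) ne cl])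
    also have "\<dots> = ft_sum M (\<lambda>s. g (ft_scale (c s x) s)) xs"
      using f(1) g \<alpha> S(3) by (intro cong) (auto simp: ft_hom_def)
    also have "\<dots> = g (ft_sum (ft_of X) (\<lambda>s. ft_scale (c s x) s) xs)"
      using X S(3) xs by (intro X.ft_hom_sum[OF g ne, symmetric]) (auto simp: ft_submodule_def)
    also have "\<dots> = g x" using eq[OF x] by (simp add: ft_sum_ft_of[OF ne] xs)
    finally show "f (p x) = g x" .
  qed
qed

text \<open>Transport of structure along an injection: \<open>ft_projective\<close> tests only
  modules over one type, so modules built over other types have to be moved there.\<close>

definition ft_image :: "('a \<Rightarrow> 'b) \<Rightarrow> 'a ft_struct \<Rightarrow> 'b ft_struct" where
  "ft_image e M = \<lparr>ft_carrier = e ` ft_carrier M,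
     ft_add = (\<lambda>x y. e (ft_add M (the_inv_into (ft_carrier M) e x) (the_inv_into (ft_carrier M) e y))),
     ft_smult = (\<lambda>a x. e (ft_smult M a (the_inv_into (ft_carrier M) e x)))\<rparr>"

lemma ft_module_ft_image:
  assumes "ft_module M" and e: "inj_on e (ft_carrier M)"
  shows "ft_module (ft_image e M)"
proof -
  interpret ft_module M by fact
  show ?thesis
    by unfold_locales
      (auto simp: ft_image_def the_inv_into_f_f[OF e] add_closed smult_closed smult_smult max_smult
        smult_add zero_smult intro!: arg_cong[where f = e] add_assoc add_commute)
qed

lemma ft_hom_ft_image:
  assumes "ft_module M" "inj_on e (ft_carrier M)"
  shows "e \<in> ft_hom M (ft_image e M)" "the_inv_into (ft_carrier M) e \<in> ft_hom (ft_image e M) M"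
  using assms by (auto simp: ft_hom_def ft_image_def the_inv_into_f_f ft_module.add_closed ft_module.smult_closed)

lemma ft_hom_comp: "f \<in> ft_hom M N \<Longrightarrow> g \<in> ft_hom N P \<Longrightarrow> (\<lambda>x. g (f x)) \<in> ft_hom M P"
  unfolding ft_hom_def by (auto simp: image_subset_iff)

lemma ft_projective_lift:
  fixes A :: "'b ft_struct" and M :: "'c ft_struct" and eA :: "'b \<Rightarrow> 'u" and eM :: "'c \<Rightarrow> 'u"
  assumes proj: "ft_projective TYPE('u) P" and A: "ft_module A" and M: "ft_module M"
    and g: "g \<in> ft_hom P M" and f: "f \<in> ft_hom A M" "f ` ft_carrier A = ft_carrier M"
    and eA: "inj_on eA (ft_carrier A)" and eM: "inj_on eM (ft_carrier M)"
  shows "\<exists>p\<in>ft_hom P A. \<forall>x\<in>ft_carrier P. f (p x) = g x"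
proof -
  let ?A = "ft_image eA A" and ?M = "ft_image eM M" and ?i = "the_inv_into (ft_carrier A) eA"
  define f' where "f' = (\<lambda>x. eM (f (?i x)))"
  have "(\<lambda>x. f (?i x)) \<in> ft_hom ?A M"
    using ft_hom_comp[OF ft_hom_ft_image(2)[OF A eA] f(1)] .
  then have f': "f' \<in> ft_hom ?A ?M"
    unfolding f'_def by (rule ft_hom_comp[OF _ ft_hom_ft_image(1)[OF M eM]])
  have "f' ` ft_carrier ?A = ft_carrier ?M"
    unfolding f'_def ft_image_def f(2)[symmetric] by (auto simp: the_inv_into_f_f[OF eA] image_iff)
  moreover have "(\<lambda>x. eM (g x)) \<in> ft_hom P ?M"
    using ft_hom_comp[OF g ft_hom_ft_image(1)[OF M eM]] .
  ultimately obtain p where p: "p \<in> ft_hom P ?A" "\<forall>x\<in>ft_carrier P. f' (p x) = eM (g x)"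
    using proj[unfolded ft_projective_def, THEN conjunct2, rule_format, of ?A ?M "\<lambda>x. eM (g x)" f']
      ft_module_ft_image[OF A eA] ft_module_ft_image[OF M eM] f' by auto
  have hom: "(\<lambda>x. ?i (p x)) \<in> ft_hom P A"
    using ft_hom_comp[OF p(1) ft_hom_ft_image(2)[OF A eA]] .
  have "f (?i (p x)) = g x" if "x \<in> ft_carrier P" for x
  proof -
    have "f (?i (p x)) \<in> ft_carrier M" using hom f that by (auto simp: ft_hom_def)
    moreover have "g x \<in> ft_carrier M" using g that by (auto simp: ft_hom_def)
    ultimately show ?thesis using p(2) that eM unfolding f'_def by (auto dest: inj_onD)
  qed
  then show ?thesis by (intro bexI[OF _ hom]) simp
qed

text \<open>Only cardinality matters here, so \<open>S\<close> may be larger than the index type: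
  the infinite set \<open>real ^ 'n\<close> is equinumerous with its square and absorbs one further
  coordinate at a time.\<close>

lemma finite_support_inj:
  assumes "finite S"
  shows "\<exists>e :: ('s \<Rightarrow> real) \<Rightarrow> real ^ 'n. inj_on e {a. \<forall>s. s \<notin> S \<longrightarrow> a s = 0}"
  using assms
proof (induction S)
  case empty
  have "{a::'s \<Rightarrow> real. \<forall>s. s \<notin> {} \<longrightarrow> a s = 0} = {\<lambda>_. 0}" by auto
  then show ?case by simp
next
  case (insert s S)
  then obtain e :: "('s \<Rightarrow> real) \<Rightarrow> real ^ 'n" where e: "inj_on e {a. \<forall>s. s \<notin> S \<longrightarrow> a s = 0}" by blast
  have "inj (\<lambda>m. vec (real m) :: real ^ 'n)" by (auto simp: inj_def vec_eq_iff)
  then have "infinite (UNIV :: (real ^ 'n) set)"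
    by (rule infinite_super[OF subset_UNIV range_inj_infinite])
  from card_of_Times_same_infinite[OF this]
  obtain \<pi> :: "(real ^ 'n) \<times> (real ^ 'n) \<Rightarrow> real ^ 'n" where \<pi>: "bij_betw \<pi> (UNIV \<times> UNIV) UNIV"
    unfolding card_of_ordIso[symmetric] by blast
  then have "inj \<pi>" unfolding bij_betw_def UNIV_Times_UNIV by (rule conjunct1)
  then have \<pi>i: "\<pi> u = \<pi> v \<longleftrightarrow> u = v" for u v
    by (rule inj_eq)
  have "inj_on (\<lambda>a. \<pi> (vec (a s), e (a(s := 0)))) {a. \<forall>t. t \<notin> insert s S \<longrightarrow> a t = 0}"
  proof (rule inj_onI)
    fix a b :: "'s \<Rightarrow> real"
    assume a: "a \<in> {a. \<forall>t. t \<notin> insert s S \<longrightarrow> a t = 0}" and b: "b \<in> {a. \<forall>t. t \<notin> insert s S \<longrightarrow> a t = 0}"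
      and eq: "\<pi> (vec (a s), e (a(s := 0))) = \<pi> (vec (b s), e (b(s := 0)))"
    then have s: "a s = b s" and "e (a(s := 0)) = e (b(s := 0))"
      unfolding \<pi>i by (auto simp: vec_eq_iff)
    then have "a(s := 0) = b(s := 0)"
      using a b by (intro inj_onD[OF e]) auto
    then show "a = b" using s by (metis fun_upd_triv fun_upd_upd)
  qed
  then show ?case by blast
qed

text \<open>
  Since residuals are finite, \<open>X\<close> is already a quotient of the module of all real-valued functions
  on a generating set, and no element \<open>-\<infinity>\<close> is needed to split off coordinates.
\<close>

lemma dual_basis_if_ft_projective:
  fixes X :: "(real ^ 'n) set"
  assumes proj: "ft_projective TYPE('u + real ^ 'n) (ft_of X)"
    and X: "ft_submodule X" and S: "finite S" "S \<noteq> {}" "S \<subseteq> X"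
    and gen: "\<And>x. x \<in> X \<Longrightarrow> x = ft_comb (\<lambda>s. ft_residual s x) S"
  obtains c where "\<And>s. s \<in> S \<Longrightarrow> ft_functional X (c s)"
    "\<And>x. x \<in> X \<Longrightarrow> x = ft_comb (\<lambda>s. c s x) S"
proof -
  \<comment> \<open>Functions are normalised to 0 outside \<open>S\<close>, and scaling respects
    this, so that the carrier is the family embedded by \<open>finite_support_inj\<close>.\<close>
  define A :: "(real ^ 'n \<Rightarrow> real) ft_struct" where
    "A = \<lparr>ft_carrier = {a. \<forall>s. s \<notin> S \<longrightarrow> a s = 0}, ft_add = (\<lambda>a b s. max (a s) (b s)),
          ft_smult = (\<lambda>r a s. if s \<in> S then r + a s else 0)\<rparr>"
  have A: "ft_module A"
    by unfold_locales (auto simp: A_def fun_eq_iff max_add_distrib_left max_add_distrib_right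
        max.assoc max.commute)
  obtain e :: "(real ^ 'n \<Rightarrow> real) \<Rightarrow> real ^ 'n" where e: "inj_on e {a. \<forall>s. s \<notin> S \<longrightarrow> a s = 0}"
    using finite_support_inj[OF S(1)] by blast
  define f where "f a = ft_comb a S" for a
  have fX: "f a \<in> X" for a unfolding f_def using S X by (rule ft_comb_in)
  have "ft_comb (\<lambda>s. if s \<in> S then r + a s else 0) S = ft_scale r (ft_comb a S)" for r a
    using ft_comb_scale[OF S(1,2), of r a] by (simp cong: ft_comb_cong)
  then have f: "f \<in> ft_hom A (ft_of X)"
    unfolding ft_hom_def using fX by (auto simp: A_def f_def ft_comb_sup[OF S(1,2)])
  have "X \<subseteq> f ` ft_carrier A"
  proof
    fix x assume x: "x \<in> X"
    define a where "a s = (if s \<in> S then ft_residual s x else 0)" for s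
    have "f a = ft_comb (\<lambda>s. ft_residual s x) S"
      unfolding f_def by (rule ft_comb_cong) (simp add: a_def)
    then have "x = f a" using gen[OF x] by simp
    then show "x \<in> f ` ft_carrier A" by (auto simp: A_def a_def)
  qed
  then have surj: "f ` ft_carrier A = ft_carrier (ft_of X)" using fX by auto
  \<comment> \<open>Lifting the identity yields a section of \<open>f\<close>, whose coordinates are
    the required functionals.\<close>
  have g: "(\<lambda>x. x) \<in> ft_hom (ft_of X) (ft_of X)" by (simp add: ft_hom_def)
  have eA: "inj_on (\<lambda>a. Inr (e a) :: 'u + real ^ 'n) (ft_carrier A)"
    using e by (simp add: A_def inj_on_def)
  have eX: "inj_on (Inr :: _ \<Rightarrow> 'u + real ^ 'n) (ft_carrier (ft_of X))" by simp
  obtain p where p: "p \<in> ft_hom (ft_of X) A" "\<forall>x\<in>X. f (p x) = x"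
    using ft_projective_lift[OF proj A ft_module_ft_of[OF X] g f surj eA eX] by auto
  show ?thesis
  proof
    show "ft_functional X (\<lambda>x. p x s)" if "s \<in> S" for s
      using p(1) that unfolding ft_hom_def ft_functional_def by (auto simp: A_def)
    show "x = ft_comb (\<lambda>s. p x s) S" if "x \<in> X" for x
      using p(2) that by (simp add: f_def)
  qed
qed

section \<open>Dual generators as coordinates\<close>

lemma topological_dim_le: "covering_dim_le T d \<Longrightarrow> topological_dim T \<le> enat d"
  unfolding topological_dim_def by (rule INF_lower) simp

lemma topological_dim_eqI:
  assumes "covering_dim_le T k" "\<And>d. covering_dim_le T d \<Longrightarrow> k \<le> d"
  shows "topological_dim T = enat k"
proof (rule antisym)
  show "enat k \<le> topological_dim T"
    unfolding topological_dim_def using assms(2) by (intro INF_greatest) simp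
qed (rule topological_dim_le[OF assms(1)])

lemma INF_enat_attained:
  assumes "(INF S\<in>A. enat (f S)) = enat k"
  obtains S where "S \<in> A" "f S = k"
proof -
  let ?B = "(\<lambda>S. enat (f S)) ` A"
  have "?B \<noteq> {}" using assms by (auto simp: top_enat_def)
  then have "Inf ?B \<in> ?B" unfolding Inf_enat_def by (auto intro: LeastI)
  then show ?thesis using assms that by auto
qed

lemma finite_positive_lower_bound:
  fixes f :: "'a \<Rightarrow> real"
  assumes "finite P" "\<And>p. p \<in> P \<Longrightarrow> f p > 0"
  obtains \<mu> where "\<mu> > 0" "\<And>p. p \<in> P \<Longrightarrow> \<mu> \<le> f p"
proof
  \<comment> \<open>The extra 1 keeps the minimum defined for empty \<open>P\<close>, a case that
    occurs when there is a single generator.\<close>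
  show "Min (insert 1 (f ` P)) > 0" using assms by auto
  show "Min (insert 1 (f ` P)) \<le> f p" if "p \<in> P" for p using assms(1) that by (intro Min_le) auto
qed

lemma isGlb_pair_iff:
  "isGlb X {x, y} z \<longleftrightarrow> z \<in> X \<and> z \<le> x \<and> z \<le> y \<and> (\<forall>w\<in>X. w \<le> x \<longrightarrow> w \<le> y \<longrightarrow> w \<le> z)"
  unfolding isGlb_def greatestP_def isLb_def setge_def setle_def by auto

lemma ft_coresidual_mono: "x \<le> y \<Longrightarrow> ft_coresidual t x \<le> ft_coresidual t y"
  using le_ft_scale_coresidual[of y t] by (simp flip: le_ft_scale_iff)

lemma ft_scale_mono_iff [simp]: "ft_scale a x \<le> ft_scale b x \<longleftrightarrow> a \<le> b"
  by (simp add: less_eq_vec_def)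

lemma ft_scale_le_ft_scale: "x \<le> y \<Longrightarrow> ft_scale a x \<le> ft_scale a y"
  by (simp add: less_eq_vec_def)

lemma ft_coresidual_scale: "ft_coresidual t (ft_scale a x) = a + ft_coresidual t x"
  using ft_coresidual_ft_functional[of UNIV t] by (simp add: ft_functional_def)

text \<open>\<open>P y\<close> says that \<open>y\<close> is the greatest lower bound in
  \<open>X\<close> of the least multiples of dual generators above it. Members of \<open>T\<close>
  satisfy this, and it survives scaling and infima formed in \<open>X\<close>. The hypothesis makes
  \<open>x\<close> a lower bound of the same multiples.\<close>

lemma dual_generators_reflect_le:
  assumes X: "ft_submodule X" and T: "dual_closed X hull T = X"
    and xy: "x \<in> X" "y \<in> X" and le: "\<forall>t\<in>T. ft_coresidual t x \<le> ft_coresidual t y"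
  shows "x \<le> y"
proof -
  define P where "P y \<longleftrightarrow> y \<in> X \<and> (\<forall>w\<in>X. (\<forall>t\<in>T. w \<le> ft_scale (ft_coresidual t y) t) \<longrightarrow> w \<le> y)" for y
  have "y \<in> dual_closed X hull T" using T xy by simp
  then have "P y"
  proof (rule hull_induct)
    fix t assume t: "t \<in> T"
    then have "t \<in> X" using hull_subset[of T "dual_closed X"] T by blast
    then show "P t" unfolding P_def using t by force
  next
    show "dual_closed X {y. P y}"
      unfolding dual_closed_def isGlb_pair_iff mem_Collect_eq
    proof (intro conjI ballI allI impI)
      fix y1 y2 z assume y: "y1 \<in> {y. P y}" "y2 \<in> {y. P y}"
        and z: "z \<in> X \<and> z \<le> y1 \<and> z \<le> y2 \<and> (\<forall>w\<in>X. w \<le> y1 \<longrightarrow> w \<le> y2 \<longrightarrow> w \<le> z)"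
      show "P z"
        unfolding P_def
      proof (intro conjI ballI impI)
        fix w assume w: "w \<in> X" "\<forall>t\<in>T. w \<le> ft_scale (ft_coresidual t z) t"
        have "w \<le> v" if v: "z \<le> v" "P v" for v
        proof -
          have "w \<le> ft_scale (ft_coresidual t v) t" if "t \<in> T" for t
          proof (rule order_trans)
            show "w \<le> ft_scale (ft_coresidual t z) t" using w that by blast
            show "ft_scale (ft_coresidual t z) t \<le> ft_scale (ft_coresidual t v) t"
              using ft_coresidual_mono[OF v(1)] by simp
          qed
          then show ?thesis using v(2) w(1) unfolding P_def by blast
        qed
        then show "w \<le> z" using y z w(1) by blast
      qed (use z in blast)
    next
      fix a y assume "y \<in> {y. P y}"
      then have y: "P y" by simp
      show "P (ft_scale a y)"
        unfolding P_def
      proof (intro conjI ballI impI)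
        show "ft_scale a y \<in> X" using y X unfolding P_def ft_submodule_def by blast
        fix w assume w: "w \<in> X" "\<forall>t\<in>T. w \<le> ft_scale (ft_coresidual t (ft_scale a y)) t"
        have "ft_scale (- a) w \<le> ft_scale (ft_coresidual t y) t" if "t \<in> T" for t
          using ft_scale_le_ft_scale[OF w(2)[rule_format, OF that], of "- a"]
          by (simp add: ft_coresidual_scale)
        moreover have "ft_scale (- a) w \<in> X" using w(1) X unfolding ft_submodule_def by blast
        ultimately have "ft_scale (- a) w \<le> y" using y unfolding P_def by blast
        from ft_scale_le_ft_scale[OF this, of a] show "w \<le> ft_scale a y" by simp
      qed
    qed
  qed
  moreover have "x \<le> ft_scale (ft_coresidual t y) t" if "t \<in> T" for t
    using le that by (simp add: le_ft_scale_iff)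
  ultimately show ?thesis using xy(1) unfolding P_def by blast
qed

lemma ft_functionals_embedding_on:
  fixes X :: "(real ^ 'n) set"
  assumes X: "ft_submodule X" and T: "\<And>t. t \<in> T \<Longrightarrow> ft_functional X (q t)"
    and reflect: "\<And>x y. x \<in> X \<Longrightarrow> y \<in> X \<Longrightarrow> (\<forall>t\<in>T. q t x \<le> q t y) \<Longrightarrow> x \<le> y"
    and U: "U \<subseteq> X" "x \<in> U" and e: "e > 0"
  shows "\<exists>\<delta>>0. \<forall>y\<in>U. (\<forall>t\<in>T. \<bar>q t y - q t x\<bar> < \<delta>) \<longrightarrow> dist y x < e"
proof -
  obtain \<delta> where d: "\<delta> > 0"
    "\<And>x y. x \<in> X \<Longrightarrow> y \<in> X \<Longrightarrow> (\<forall>t\<in>T. \<bar>q t y - q t x\<bar> \<le> \<delta>) \<Longrightarrow> dist y x < e"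
    by (rule ft_functionals_embedding[OF X T reflect e]) blast+
  have "dist y x < e" if "y \<in> U" "\<forall>t\<in>T. \<bar>q t y - q t x\<bar> < \<delta>" for y
    using that U by (intro d(2)) (auto intro: less_imp_le)
  then show ?thesis using d(1) by blast
qed

lemma covering_dim_le_functionals:
  fixes X :: "(real ^ 'n) set"
  assumes "finite T" and X: "ft_submodule X" and T: "\<And>t. t \<in> T \<Longrightarrow> ft_functional X (q t)"
    and reflect: "\<And>x y. x \<in> X \<Longrightarrow> y \<in> X \<Longrightarrow> (\<forall>t\<in>T. q t x \<le> q t y) \<Longrightarrow> x \<le> y"
    and U: "U \<subseteq> X"
  shows "covering_dim_le (top_of_set U) (card T)"
proof (rule covering_dim_le_card_coordinates[where \<phi> = q])
  show "continuous_on U (q t)" if "t \<in> T" for t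
    using ft_functional_continuous_on[OF X T[OF that]] U by (rule continuous_on_subset)
  show "\<exists>\<delta>>0. \<forall>y\<in>U. (\<forall>t\<in>T. \<bar>q t y - q t x\<bar> < \<delta>) \<longrightarrow> dist y x < e" if "x \<in> U" "e > 0" for x e
    by (rule ft_functionals_embedding_on[OF X T reflect U that])
qed fact

lemma covering_dim_le_dual_generators:
  fixes X :: "(real ^ 'n) set"
  assumes "ft_submodule X" "finite T" "dual_closed X hull T = X"
  shows "covering_dim_le (top_of_set X) (card T)"
  by (rule covering_dim_le_functionals[OF assms(2,1) ft_coresidual_ft_functional
        dual_generators_reflect_le[OF assms(1,3)] order_refl])

lemma ft_polytope_generators:
  assumes "X \<noteq> {}" "finite S" "ft_submodule hull S = X"
  shows "ft_submodule X" "S \<noteq> {}" "S \<subseteq> X"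
    "\<And>x. x \<in> X \<Longrightarrow> x = ft_comb (\<lambda>s. ft_residual s x) S"
proof -
  show "ft_submodule X" using ft_submodule_hull[of S] assms(3) by simp
  show "S \<subseteq> X" using hull_subset[of S ft_submodule] assms(3) by simp
  show "S \<noteq> {}"
  proof
    assume "S = {}"
    then have "ft_submodule hull S \<subseteq> {}" by (intro hull_minimal) (auto simp: ft_submodule_def)
    then show False using assms(1,3) by simp
  qed
  show "x = ft_comb (\<lambda>s. ft_residual s x) S" if "x \<in> X" for x
    using ft_submodule_hull_comb[OF assms(2)] assms(3) that by blast
qed

text \<open>A residual need not be a functional, so its Lipschitz bound is derived from its own
  adjunction.\<close>

lemma ft_residual_continuous_on: "continuous_on X (ft_residual s)"
  unfolding continuous_on_iff
proof (intro ballI allI impI)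
  have le: "ft_residual s x \<le> dist x y + ft_residual s y" for x y
  proof -
    have "ft_scale (ft_residual s x) s \<le> ft_scale (dist x y) y"
      using ft_scale_residual_le le_ft_scale_dist by (rule order_trans)
    from ft_scale_le_ft_scale[OF this, of "- dist x y"]
    have "ft_scale (ft_residual s x - dist x y) s \<le> y" by simp
    then show ?thesis by (simp add: ft_scale_le_iff)
  qed
  fix x e assume e: "(0::real) < e"
  have "dist (ft_residual s y) (ft_residual s x) < e" if "dist y x < e" for y
    using le[of x y] le[of y x] that by (simp add: dist_real_def dist_commute abs_less_iff)
  then show "\<exists>d>0. \<forall>y\<in>X. dist y x < d \<longrightarrow> dist (ft_residual s y) (ft_residual s x) < e"
    using e by blast
qed

section \<open>Pure dimension implies projectivity\<close>

text \<open>
  Let \<open>A t s\<close> be the coefficient of the dual generator \<open>t\<close> at the generator \<open>s\<close>. At a point not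
  lying on finitely many hyperplanes each generator touches exactly one dual generator, which gives
  a bijection \<open>\<sigma>\<close> from generators to dual generators. It is the unique maximiser of
  \<open>\<Sum>s. A (\<sigma> s) s\<close>, hence independent of the point; by purity these points are dense,
  so that each residual is, up to a constant, a coresidual, and thus a functional.
\<close>

lemma ft_projective_if_pure_dim:
  fixes X :: "(real ^ 'n) set"
  assumes ne: "X \<noteq> {}" and S: "finite S" "ft_submodule hull S = X" "card S = k"
    and T: "finite T" "dual_closed X hull T = X" "card T = k" and pure: "pure_dim X k"
  shows "ft_projective TYPE('u) (ft_of X)"
proof -
  note gen = ft_polytope_generators[OF ne S(1,2)]
  note X = gen(1)
  note reflect = dual_generators_reflect_le[OF X T(2)]
  let ?r = ft_residual and ?q = ft_coresidual
  have ge: "?r s u + ?q t s \<le> ?q t u" for s t u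
    using ft_coresidual_mono[OF ft_scale_residual_le[of s u], of t] by (simp add: ft_coresidual_scale)
  define N where "N s u = {t\<in>T. ?q t u = ?r s u + ?q t s}" for s u
  \<comment> \<open>If no dual generator were touched, finiteness of \<open>T\<close> would leave a
    gap \<mu> by which the coefficient of \<open>s\<close> could be raised, contrary to its
    maximality.\<close>
  have N_ne: "\<exists>t. t \<in> N s u" if su: "s \<in> S" "u \<in> X" for s u
  proof (rule ccontr)
    assume "\<nexists>t. t \<in> N s u"
    then have "?q t u - (?r s u + ?q t s) > 0" if "t \<in> T" for t
      using ge[of s u t] that unfolding N_def by fastforce
    from finite_positive_lower_bound[of T "\<lambda>t. ?q t u - (?r s u + ?q t s)", OF T(1) this]
    obtain \<mu> where \<mu>: "\<mu> > 0" "\<And>t. t \<in> T \<Longrightarrow> \<mu> \<le> ?q t u - (?r s u + ?q t s)" by blast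
    have "ft_scale (?r s u + \<mu>) s \<le> u"
    proof (rule reflect)
      show "ft_scale (?r s u + \<mu>) s \<in> X" using X gen(3) su(1) unfolding ft_submodule_def by blast
      show "\<forall>t\<in>T. ?q t (ft_scale (?r s u + \<mu>) s) \<le> ?q t u"
        using \<mu>(2) by (fastforce simp: ft_coresidual_scale)
    qed (rule su)
    then show False using \<mu>(1) by (simp add: ft_scale_le_iff)
  qed
  \<comment> \<open>A functional turns the expansion of \<open>u\<close> in residuals into a finite
    maximum, which some \<open>s\<close> attains.\<close>
  have N_cover: "\<exists>s\<in>S. t \<in> N s u" if tu: "t \<in> T" "u \<in> X" for t u
  proof -
    have "?q t (ft_comb (\<lambda>s. ?r s u) S) = Max ((\<lambda>s. ?r s u + ?q t s) ` S)"
      by (rule ft_functional_comb[OF S(1) gen(2,3) X ft_coresidual_ft_functional])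
    then have "?q t u = Max ((\<lambda>s. ?r s u + ?q t s) ` S)"
      using gen(4)[OF tu(2)] by simp
    also have "\<dots> \<in> (\<lambda>s. ?r s u + ?q t s) ` S" using S(1) gen(2) by simp
    finally show ?thesis unfolding N_def using tu(1) by auto
  qed
  define full where "full u \<longleftrightarrow> u \<in> X \<and> (\<forall>s\<in>S. \<forall>t\<in>N s u. \<forall>t'\<in>N s u. t = t')" for u
  have dense: "\<exists>u\<in>U. full u" if U: "openin (top_of_set X) U" "U \<noteq> {}" for U
  proof (rule ccontr)
    assume nf: "\<not> (\<exists>u\<in>U. full u)"
    have UX: "U \<subseteq> X" using openin_subset[OF U(1)] by simp
    define C where "C = (\<lambda>(s, t, t'). ?q t s - ?q t' s) ` (S \<times> T \<times> T)"
    have "covering_dim_le (top_of_set U) (card T - 1)"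
    proof (rule covering_dim_le_hyperplanes[where \<phi> = ft_coresidual and C = C])
      show "continuous_on U (?q t)" for t
        using ft_functional_continuous_on[OF X ft_coresidual_ft_functional] UX
        by (rule continuous_on_subset)
      show "\<exists>\<delta>>0. \<forall>y\<in>U. (\<forall>t\<in>T. \<bar>?q t y - ?q t x\<bar> < \<delta>) \<longrightarrow> dist y x < e" if "x \<in> U" "e > 0" for x e
        by (rule ft_functionals_embedding_on[OF X ft_coresidual_ft_functional reflect UX that])
      show "countable C" unfolding C_def using S(1) T(1) by (intro countable_finite) simp
      fix u assume u: "u \<in> U"
      then obtain s t t' where "s \<in> S" "t \<in> N s u" "t' \<in> N s u" "t \<noteq> t'"
        using nf UX unfolding full_def by blast
      then have "t \<in> T" "t' \<in> T" "t \<noteq> t'" "?q t u - ?q t' u = ?q t s - ?q t' s"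
        unfolding N_def by auto
      moreover have "?q t s - ?q t' s \<in> C"
        unfolding C_def using calculation \<open>s \<in> S\<close> by (intro image_eqI[of _ _ "(s, t, t')"]) auto
      ultimately show "\<exists>t\<in>T. \<exists>t'\<in>T. t \<noteq> t' \<and> ?q t u - ?q t' u \<in> C" by metis
    qed fact
    then have "topological_dim (top_of_set U) \<le> enat (k - 1)"
      using T(3) by (simp add: topological_dim_le)
    moreover have "topological_dim (top_of_set U) = enat k"
      using pure U unfolding pure_dim_def by blast
    \<comment> \<open>For \<open>k = 0\<close> the truncated \<open>k - 1\<close> would equal
      \<open>k\<close>, and the bound would contradict nothing.\<close>
    moreover have "k > 0" using S gen(2) by (auto simp: card_gt_0_iff)
    ultimately show False by simp
  qed
  define \<sigma> where "\<sigma> u s = (SOME t. t \<in> N s u)" for u s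
  have \<sigma>N: "\<sigma> u s \<in> N s u" if "u \<in> X" "s \<in> S" for u s
    unfolding \<sigma>_def using N_ne[OF that(2,1)] by (rule someI_ex)
  have \<sigma>T: "\<sigma> u s \<in> T" "?q (\<sigma> u s) u = ?r s u + ?q (\<sigma> u s) s" if "u \<in> X" "s \<in> S" for u s
    using \<sigma>N[OF that] unfolding N_def by auto
  have bij: "bij_betw (\<sigma> u) S T" if u: "full u" for u
  proof -
    have uX: "u \<in> X" using u unfolding full_def by blast
    have "\<sigma> u ` S = T"
    proof
      show "\<sigma> u ` S \<subseteq> T" using \<sigma>T(1)[OF uX] by blast
      show "T \<subseteq> \<sigma> u ` S"
      proof
        fix t assume "t \<in> T"
        then obtain s where s: "s \<in> S" "t \<in> N s u" using N_cover uX by blast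
        then have "t = \<sigma> u s" using u \<sigma>N[OF uX s(1)] unfolding full_def by blast
        then show "t \<in> \<sigma> u ` S" using s(1) by blast
      qed
    qed
    \<comment> \<open>Equality of generator and dual dimension enters here: a surjection between
      finite sets of the same size is injective.\<close>
    moreover have "inj_on (\<sigma> u) S"
      using calculation S(1,3) T(3) by (intro eq_card_imp_inj_on) auto
    ultimately show ?thesis unfolding bij_betw_def by blast
  qed
  \<comment> \<open>Both assignments are evaluated at \<open>u\<close>: \<sigma> u is tight there
    for every \<open>s\<close>, while \<sigma> v is not tight at \<open>s0\<close>. Summed over the
    bijections the coresiduals of \<open>u\<close> agree, and the residuals of \<open>u\<close>
    cancel. Exchanging \<open>u\<close> and \<open>v\<close> gives the opposite strict
    inequality.\<close>
  have less: "(\<Sum>s\<in>S. ?q (\<sigma> v s) s) < (\<Sum>s\<in>S. ?q (\<sigma> u s) s)"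
    if uv: "full u" "full v" "s0 \<in> S" "\<sigma> u s0 \<noteq> \<sigma> v s0" for u v s0
  proof -
    have X': "u \<in> X" "v \<in> X" using uv unfolding full_def by blast+
    have "(\<Sum>s\<in>S. ?r s u + ?q (\<sigma> v s) s) < (\<Sum>s\<in>S. ?q (\<sigma> v s) u)"
    proof (rule sum_strict_mono_ex1[OF S(1)])
      show "\<forall>s\<in>S. ?r s u + ?q (\<sigma> v s) s \<le> ?q (\<sigma> v s) u" using ge by blast
      have "\<sigma> v s0 \<notin> N s0 u" using uv \<sigma>N[OF X'(1) uv(3)] unfolding full_def by metis
      then have "?r s0 u + ?q (\<sigma> v s0) s0 \<noteq> ?q (\<sigma> v s0) u"
        using \<sigma>T(1)[OF X'(2) uv(3)] unfolding N_def by auto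
      then show "\<exists>s\<in>S. ?r s u + ?q (\<sigma> v s) s < ?q (\<sigma> v s) u"
        using ge[of s0 u "\<sigma> v s0"] uv(3) by (intro bexI[of _ s0]) auto
    qed
    also have "\<dots> = (\<Sum>t\<in>T. ?q t u)" using bij[OF uv(2)] by (rule sum.reindex_bij_betw)
    also have "\<dots> = (\<Sum>s\<in>S. ?q (\<sigma> u s) u)" using bij[OF uv(1)] by (rule sum.reindex_bij_betw[symmetric])
    also have "\<dots> = (\<Sum>s\<in>S. ?r s u + ?q (\<sigma> u s) s)" using \<sigma>T(2)[OF X'(1)] by (intro sum.cong) auto
    finally show ?thesis by (simp add: sum.distrib)
  qed
  obtain u0 where u0: "full u0" using dense[of X] ne by auto
  have same: "\<sigma> u s = \<sigma> u0 s" if "full u" "s \<in> S" for u s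
    using less[OF that(1) u0 that(2)] less[OF u0 that(1) that(2)] by fastforce
  \<comment> \<open>Both sides are continuous and agree at the full points, which are dense.\<close>
  have res: "?r s u = ?q (\<sigma> u0 s) u - ?q (\<sigma> u0 s) s" if s: "s \<in> S" and u: "u \<in> X" for s u
  proof (rule ccontr)
    assume neq: "?r s u \<noteq> ?q (\<sigma> u0 s) u - ?q (\<sigma> u0 s) s"
    define f where "f x = ?r s x - (?q (\<sigma> u0 s) x - ?q (\<sigma> u0 s) s)" for x
    define U where "U = X \<inter> f -` (- {0})"
    have "continuous_on X f"
      unfolding f_def using ft_functional_continuous_on[OF X ft_coresidual_ft_functional]
      by (intro continuous_intros ft_residual_continuous_on) auto
    then have "openin (top_of_set X) U"
      unfolding U_def by (intro continuous_openin_preimage_gen) auto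
    moreover have "u \<in> U" unfolding U_def f_def using u neq by simp
    ultimately obtain x where x: "x \<in> U" "full x" using dense[of U] by blast
    have "?q (\<sigma> u0 s) x = ?r s x + ?q (\<sigma> u0 s) s"
      using \<sigma>T(2)[of x s] same[OF x(2) s] x s unfolding U_def by auto
    then show False using x(1) unfolding U_def f_def by simp
  qed
  show ?thesis
  proof (rule ft_projective_if_dual_basis[OF X S(1) gen(2,3) _ gen(4)])
    fix s assume s: "s \<in> S"
    show "ft_functional X (?r s)"
      unfolding ft_functional_def
    proof (intro conjI ballI allI)
      fix x y assume xy: "x \<in> X" "y \<in> X"
      then have "sup x y \<in> X" using X unfolding ft_submodule_def by blast
      then show "?r s (sup x y) = max (?r s x) (?r s y)"
        using res[OF s] xy ft_coresidual_ft_functional[of X "\<sigma> u0 s"] unfolding ft_functional_def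
        by (simp add: max_def)
    next
      fix a x assume x: "x \<in> X"
      then have "ft_scale a x \<in> X" using X unfolding ft_submodule_def by blast
      then show "?r s (ft_scale a x) = a + ?r s x"
        using res[OF s] x by (simp add: ft_coresidual_scale)
    qed
  qed
qed

section \<open>Projectivity implies pure dimension\<close>

lemma continuous_on_ft_comb:
  fixes S :: "(real ^ 'n) set"
  assumes "finite S" "S \<noteq> {}" and cont: "\<And>s. s \<in> S \<Longrightarrow> continuous_on K (\<lambda>z. a z s)"
  shows "continuous_on K (\<lambda>z. ft_comb (a z) S)"
proof -
  have "continuous_on K (\<lambda>z. Max ((\<lambda>s. a z s + s $ i) ` S))" for i
    using assms
  proof (induction rule: finite_ne_induct)
    case (singleton s)
    then show ?case by (auto intro!: continuous_intros)
  next
    case (insert s S)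
    then have "continuous_on K (\<lambda>z. max (a z s + s $ i) (Max ((\<lambda>s. a z s + s $ i) ` S)))"
      by (intro continuous_intros) auto
    then show ?case using insert by simp
  qed
  then show ?thesis unfolding ft_comb_def by (intro continuous_on_vec_lambda)
qed

text \<open>\<open>irredundant\<close> is what minimality of a generating set supplies; it is
  restricted to non-empty \<open>S - {s}\<close> because an empty combination carries no
  meaning.\<close>

locale ft_dual_basis =
  fixes X S :: "(real ^ 'n) set" and c :: "real ^ 'n \<Rightarrow> real ^ 'n \<Rightarrow> real"
  assumes X: "ft_submodule X" and S: "finite S" "S \<noteq> {}" "S \<subseteq> X"
    and functional: "\<And>s. s \<in> S \<Longrightarrow> ft_functional X (c s)"
    and basis: "\<And>x. x \<in> X \<Longrightarrow> x = ft_comb (\<lambda>s. c s x) S"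
    and irredundant: "\<And>s a. s \<in> S \<Longrightarrow> S - {s} \<noteq> {} \<Longrightarrow> s \<noteq> ft_comb a (S - {s})"
begin

section \<open>The coordinate matrix of an irredundant dual basis\<close>

lemma coord_le: "x \<in> X \<Longrightarrow> s \<in> S \<Longrightarrow> ft_scale (c s x) s \<le> x"
  using ft_comb_le_iff[OF S(1,2), of "\<lambda>s. c s x" x] basis[of x] by simp

lemma reflect_le:
  assumes "x \<in> X" "y \<in> X" "\<forall>s\<in>S. c s x \<le> c s y"
  shows "x \<le> y"
  using ft_comb_mono[OF S(1,2), of "\<lambda>s. c s x" "\<lambda>s. c s y"] assms basis[of x] basis[of y] by simp

lemma coord_scale: "x \<in> X \<Longrightarrow> s \<in> S \<Longrightarrow> c s (ft_scale a x) = a + c s x"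
  using functional by (simp add: ft_functional_def)

text \<open>Apply \<open>c s\<close> to the inequality \<open>coord_le\<close> for \<open>t\<close>.
  For \<open>x\<close> in \<open>S\<close>, together with \<open>coord_self\<close>, this makes the
  matrix \<open>c s t\<close> a tropical Kleene star.\<close>

lemma coord_triangle:
  assumes "x \<in> X" "s \<in> S" "t \<in> S"
  shows "c t x + c s t \<le> c s x"
proof -
  have t: "t \<in> X" using S assms by blast
  then have "ft_scale (c t x) t \<in> X" using X unfolding ft_submodule_def by blast
  then have "c s (ft_scale (c t x) t) \<le> c s x"
    using ft_functional_mono[OF X functional[OF assms(2)] _ assms(1) coord_le[OF assms(1,3)]] by blast
  then show ?thesis by (simp add: coord_scale[OF t assms(2)])
qed

text \<open>If another generator reached \<open>s\<close> in every coordinate, \<open>s\<close>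
  would be the combination of the others with coefficients \<open>c t s\<close>.\<close>

lemma exposed_index:
  assumes s: "s \<in> S"
  obtains i where "\<And>t. t \<in> S - {s} \<Longrightarrow> c t s + t $ i < s $ i"
proof (cases "S - {s} = {}")
  case False
  have sX: "s \<in> X" using S s by blast
  have "\<exists>i. \<forall>t\<in>S-{s}. c t s + t $ i < s $ i"
  proof (rule ccontr)
    assume "\<nexists>i. \<forall>t\<in>S-{s}. c t s + t $ i < s $ i"
    then have att: "\<exists>t\<in>S-{s}. s $ i \<le> c t s + t $ i" for i by (metis not_le)
    have "s = ft_comb (\<lambda>t. c t s) (S - {s})"
    proof (rule antisym)
      show "s \<le> ft_comb (\<lambda>t. c t s) (S - {s})"
        unfolding less_eq_vec_def
      proof
        fix i
        obtain t where "t \<in> S - {s}" "s $ i \<le> c t s + t $ i" using att by blast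
        then show "s $ i \<le> ft_comb (\<lambda>t. c t s) (S - {s}) $ i"
          using ft_comb_nth_ge[of "S - {s}" t "\<lambda>t. c t s" i] S(1) by simp
      qed
      show "ft_comb (\<lambda>t. c t s) (S - {s}) \<le> s"
        using False S(1) coord_le[OF sX] by (subst ft_comb_le_iff) auto
    qed
    then show False using irredundant[OF s False] by blast
  qed
  then show ?thesis using that by blast
qed (use that in blast)

text \<open>At the exposed coordinate only the term of \<open>s\<close> itself can attain the
  maximum in the expansion of \<open>s\<close>.\<close>

lemma coord_self:
  assumes s: "s \<in> S"
  shows "c s s = 0"
proof -
  have sX: "s \<in> X" using S s by blast
  obtain i where i: "\<And>t. t \<in> S - {s} \<Longrightarrow> c t s + t $ i < s $ i" using exposed_index[OF s] by blast
  obtain t where t: "t \<in> S" "ft_comb (\<lambda>t. c t s) S $ i = c t s + t $ i"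
    by (rule ft_comb_nth_attained[OF S(1,2)])
  then have "s $ i = c t s + t $ i" using basis[OF sX] by simp
  then show ?thesis using i[of t] t(1) by (cases "t = s") auto
qed

text \<open>Compare \<open>coord_le\<close> for \<open>s\<close> below \<open>t\<close> with the
  exposed coordinate of \<open>s\<close>. The strictness obtained here is what gives the cone an
  interior.\<close>

lemma coord_antisym:
  assumes s: "s \<in> S" and t: "t \<in> S" and ne: "s \<noteq> t"
  shows "c s t + c t s < 0"
proof (rule ccontr)
  assume "\<not> c s t + c t s < 0"
  have X': "s \<in> X" "t \<in> X" using S s t by blast+
  obtain i where i: "\<And>t. t \<in> S - {s} \<Longrightarrow> c t s + t $ i < s $ i" using exposed_index[OF s] by blast
  have "c s t + s $ i \<le> t $ i"
    using coord_le[OF X'(2) s] unfolding less_eq_vec_def by simp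
  then show False using i[of t] t ne \<open>\<not> c s t + c t s < 0\<close> by force
qed

definition cone :: "(real ^ 'n \<Rightarrow> real) \<Rightarrow> bool" where
  "cone y \<longleftrightarrow> (\<forall>s\<in>S. \<forall>t\<in>S. y t + c s t \<le> y s)"

lemma comb_in: "ft_comb y S \<in> X"
  using S X by (intro ft_comb_in)

text \<open>On the cone no term exceeds \<open>y s\<close>, and the term \<open>t = s\<close> equals
  it because the diagonal vanishes; so combining inverts the coordinate map.\<close>

lemma coord_comb:
  assumes "cone y" and s: "s \<in> S"
  shows "c s (ft_comb y S) = y s"
proof -
  have "c s (ft_comb y S) = Max ((\<lambda>t. y t + c s t) ` S)"
    by (rule ft_functional_comb[OF S X functional[OF s]])
  also have "\<dots> = y s"
  proof (rule Max_eqI)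
    show "y s \<in> (\<lambda>t. y t + c s t) ` S" using s by (intro image_eqI[of _ _ s]) (simp_all add: coord_self)
  qed (use S(1) assms in \<open>auto simp: cone_def\<close>)
  finally show ?thesis .
qed

text \<open>The ordinary barycentre of the coordinate vectors of the generators. All of them lie in
  the cone, and that of \<open>s\<close> satisfies the inequality for a pair \<open>s\<close>,
  \<open>t\<close> strictly, so the average satisfies all of them strictly.\<close>

definition centre :: "real ^ 'n \<Rightarrow> real" where
  "centre s = (\<Sum>r\<in>S. c s r) / card S"

lemma centre_interior:
  assumes s: "s \<in> S" and t: "t \<in> S" and ne: "s \<noteq> t"
  shows "centre t + c s t < centre s"
proof -
  have "(\<Sum>r\<in>S. c t r + c s t) < (\<Sum>r\<in>S. c s r)"
  proof (rule sum_strict_mono_ex1[OF S(1)])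
    show "\<forall>r\<in>S. c t r + c s t \<le> c s r" using coord_triangle[OF _ s t] S(3) by blast
    show "\<exists>r\<in>S. c t r + c s t < c s r"
      using coord_antisym[OF s t ne] coord_self[OF s] s by (intro bexI[of _ s]) auto
  qed
  then have "(\<Sum>r\<in>S. c t r) + card S * c s t < (\<Sum>r\<in>S. c s r)"
    by (simp add: sum.distrib)
  moreover have k: "real (card S) > 0" using S by (simp add: card_gt_0_iff)
  ultimately have "((\<Sum>r\<in>S. c t r) + card S * c s t) / card S < (\<Sum>r\<in>S. c s r) / card S"
    by (rule divide_strict_right_mono)
  then show ?thesis unfolding centre_def using k by (simp add: add_divide_distrib)
qed

text \<open>This makes room in \<open>real ^ 'n\<close> for a coordinate subspace of dimension
  \<open>card S\<close>. If \<open>s\<close> were strictly alone in no coordinate of the combination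
  at \<open>centre\<close>, it could be omitted there; but by \<open>centre_interior\<close> the
  remaining terms give \<open>c s\<close> a value below \<open>centre s\<close>.\<close>

lemma private_coordinates:
  obtains i :: "real ^ 'n \<Rightarrow> 'n" where "inj_on i S"
proof -
  have "\<exists>i. \<forall>t\<in>S-{s}. centre t + t $ i < centre s + s $ i" if s: "s \<in> S" for s
  proof (rule ccontr)
    assume "\<nexists>i. \<forall>t\<in>S-{s}. centre t + t $ i < centre s + s $ i"
    then have att: "\<exists>t\<in>S-{s}. centre s + s $ i \<le> centre t + t $ i" for i by (metis not_le)
    then have ne: "S - {s} \<noteq> {}" by blast
    have "ft_scale (centre s) s \<le> ft_comb centre (S - {s})"
      unfolding less_eq_vec_def
    proof
      fix i
      obtain t where "t \<in> S - {s}" "centre s + s $ i \<le> centre t + t $ i" using att by blast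
      then show "ft_scale (centre s) s $ i \<le> ft_comb centre (S - {s}) $ i"
        using ft_comb_nth_ge[of "S - {s}" t centre i] S(1) by simp
    qed
    then have "ft_comb centre (insert s (S - {s})) = ft_comb centre (S - {s})"
      using S(1) ne by (subst ft_comb_insert) (auto simp: sup.absorb2)
    then have "ft_comb centre S = ft_comb centre (S - {s})" using s by (simp add: insert_absorb)
    then have "c s (ft_comb centre S) = Max ((\<lambda>t. centre t + c s t) ` (S - {s}))"
      using ft_functional_comb[of "S - {s}" X "c s" centre] S X functional[OF s] ne by auto
    also have "\<dots> < centre s"
      using S(1) ne centre_interior[OF s] by (subst Max_less_iff) auto
    also have "centre s = c s (ft_comb centre S)"
    proof (rule coord_comb[symmetric, OF _ s])
      show "cone centre" unfolding cone_def
      proof (intro ballI)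
        fix s t assume "s \<in> S" "t \<in> S"
        then show "centre t + c s t \<le> centre s"
          using centre_interior[of s t] coord_self[of s] by (cases "s = t") auto
      qed
    qed
    finally show False by simp
  qed
  then obtain i where i: "\<And>s t. s \<in> S \<Longrightarrow> t \<in> S - {s} \<Longrightarrow> centre t + t $ i s < centre s + s $ i s"
    by metis
  have "inj_on i S"
  proof (rule inj_onI, rule ccontr)
    fix s t assume "s \<in> S" "t \<in> S" "i s = i t" "s \<noteq> t"
    then show False using i[of s t] i[of t s] by force
  qed
  then show ?thesis by (rule that)
qed

lemma covering_dim_ge:
  assumes U: "openin (top_of_set X) U" "U \<noteq> {}" and cov: "covering_dim_le (top_of_set U) d"
  shows "card S \<le> d"
proof -
  obtain i :: "real ^ 'n \<Rightarrow> 'n" where i: "inj_on i S" by (rule private_coordinates)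
  obtain u where u: "u \<in> U" using U(2) by blast
  have UX: "U \<subseteq> X" using openin_subset[OF U(1)] by simp
  have "\<exists>r>0. \<forall>x\<in>X. dist x u < r \<longrightarrow> x \<in> U"
    using U(1) u unfolding openin_euclidean_subtopology_iff by blast
  then obtain r where r: "r > 0" "\<And>x. x \<in> X \<Longrightarrow> dist x u < r \<Longrightarrow> x \<in> U" by blast
  obtain \<delta> where \<delta>: "\<delta> > 0"
      "\<And>x y. x \<in> X \<Longrightarrow> y \<in> X \<Longrightarrow> (\<forall>s\<in>S. \<bar>c s y - c s x\<bar> \<le> \<delta>) \<Longrightarrow> dist y x < r"
    by (rule ft_functionals_embedding[OF X functional reflect_le r(1)]) blast+
  \<comment> \<open>The summand 1 makes \<open>B\<close> positive, so that it can be a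
    divisor.\<close>
  define B where "B = (\<Sum>s\<in>S. \<bar>centre s - c s u\<bar>) + 1"
  have B: "\<bar>centre s - c s u\<bar> \<le> B" if "s \<in> S" for s
    using member_le_sum[OF that, of "\<lambda>s. \<bar>centre s - c s u\<bar>"] S(1) unfolding B_def by simp
  have B1: "B > 0" unfolding B_def by (simp add: add_nonneg_pos sum_nonneg)
  \<comment> \<open>Moving from \<open>u\<close> towards \<open>centre\<close> costs at most half of
    the tolerance \<delta>; the ball gets the other half.\<close>
  define \<theta> where "\<theta> = min 1 (\<delta> / (2 * B))"
  have \<theta>: "\<theta> > 0" "\<theta> \<le> 1" "\<theta> * B \<le> \<delta> / 2"
  proof -
    show "\<theta> > 0" "\<theta> \<le> 1" unfolding \<theta>_def using \<delta>(1) B1 by auto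
    have "\<theta> * B \<le> \<delta> / (2 * B) * B" unfolding \<theta>_def using B1 by (intro mult_right_mono) auto
    then show "\<theta> * B \<le> \<delta> / 2" using B1 by simp
  qed
  define gap where "gap = (\<lambda>(s, t). centre s - centre t - c s t)"
  define P where "P = {p\<in>S \<times> S. fst p \<noteq> snd p}"
  have "finite P" unfolding P_def using S(1) by simp
  moreover have "0 < gap p" if "p \<in> P" for p
    using that centre_interior unfolding P_def gap_def by (auto simp: algebra_simps)
  ultimately obtain \<mu> where \<mu>: "\<mu> > 0" "\<And>p. p \<in> P \<Longrightarrow> \<mu> \<le> gap p"
    by (rule finite_positive_lower_bound) blast+
  \<comment> \<open>Two coordinates may move by \<eta> in opposite directions, so twice \<eta> must
    fit into the slack, which is at least \<theta> times \<mu>.\<close>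
  define \<eta> where "\<eta> = min (\<delta> / 2) (\<theta> * \<mu> / 2)"
  have \<eta>: "\<eta> > 0" "\<eta> \<le> \<delta> / 2" "2 * \<eta> \<le> \<theta> * \<mu>"
    unfolding \<eta>_def using \<delta>(1) \<theta>(1) \<mu>(1) by auto
  \<comment> \<open>The coordinates of \<open>u\<close> may lie on the boundary of the cone; a small
    step towards the interior point \<open>centre\<close> leaves it.\<close>
  define w where "w s = (1 - \<theta>) * c s u + \<theta> * centre s" for s
  have w: "w t + c s t + 2 * \<eta> \<le> w s" if "s \<in> S" "t \<in> S" "s \<noteq> t" for s t
  proof -
    have "\<mu> \<le> centre s - centre t - c s t" using \<mu>(2)[of "(s, t)"] that unfolding P_def gap_def by simp
    then have "\<theta> * (centre t + c s t + \<mu>) \<le> \<theta> * centre s"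
      using \<theta>(1) by (intro mult_left_mono) auto
    moreover have "(1 - \<theta>) * (c t u + c s t) \<le> (1 - \<theta>) * c s u"
      using \<theta>(2) coord_triangle[of u s t] that u UX by (intro mult_left_mono) auto
    ultimately show ?thesis unfolding w_def using \<eta>(3) by (simp add: algebra_simps)
  qed
  define y where "y z s = w s + \<eta> * z $ i s" for z :: "real ^ 'n" and s
  define L where "L = {z :: real ^ 'n. \<forall>j. j \<notin> i ` S \<longrightarrow> z $ j = 0}"
  define h where "h z = ft_comb (y z) S" for z
  let ?K = "cball 0 1 \<inter> L"
  have zi: "\<bar>\<eta> * z $ j\<bar> \<le> \<eta>" if "z \<in> ?K" for z j
  proof -
    have "\<bar>z $ j\<bar> \<le> 1" using component_le_norm_cart[of z j] that by simp
    then show ?thesis using \<eta>(1) mult_left_mono[of "\<bar>z $ j\<bar>" 1 \<eta>] by (simp add: abs_mult)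
  qed
  have cone: "cone (y z)" if z: "z \<in> ?K" for z
    unfolding cone_def
  proof (intro ballI)
    fix s t assume st: "s \<in> S" "t \<in> S"
    show "y z t + c s t \<le> y z s"
    proof (cases "s = t")
      case False
      then show ?thesis
        using w[OF st False] zi[OF z, of "i s"] zi[OF z, of "i t"] unfolding y_def by (simp add: abs_le_iff)
    qed (use coord_self st in simp)
  qed
  have coord: "c s (h z) = y z s" if "z \<in> ?K" "s \<in> S" for z s
    unfolding h_def by (rule coord_comb[OF cone[OF that(1)] that(2)])
  have L: "subspace L" unfolding L_def by (auto simp: subspace_def)
  have "covering_dim_le (top_of_set ?K) d"
  proof (rule covering_dim_le_compact_embedding[OF cov])
    show "compact ?K" using closed_subspace[OF L] by (simp add: compact_Int_closed)
    show "continuous_on ?K h"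
      unfolding h_def by (rule continuous_on_ft_comb[OF S(1,2)]) (auto simp: y_def intro!: continuous_intros)
    show "inj_on h ?K"
    proof (rule inj_onI)
      fix z z' assume z: "z \<in> ?K" "z' \<in> ?K" "h z = h z'"
      have "z $ j = z' $ j" for j
      proof (cases "j \<in> i ` S")
        case True
        then obtain s where s: "s \<in> S" "j = i s" by blast
        have "y z s = y z' s" using coord[OF z(1) s(1)] coord[OF z(2) s(1)] z(3) by simp
        then show ?thesis unfolding y_def using s \<eta>(1) by simp
      next
        case False
        then show ?thesis using z unfolding L_def by simp
      qed
      then show "z = z'" by (simp add: vec_eq_iff)
    qed
    show "h ` ?K \<subseteq> U"
    proof
      fix x assume "x \<in> h ` ?K"
      then obtain z where z: "z \<in> ?K" "x = h z" by blast
      have "\<bar>c s (h z) - c s u\<bar> \<le> \<delta>" if "s \<in> S" for s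
      proof -
        have "y z s - c s u = \<theta> * (centre s - c s u) + \<eta> * z $ i s"
          unfolding y_def w_def by (simp add: algebra_simps)
        moreover have "\<bar>\<theta> * (centre s - c s u)\<bar> \<le> \<theta> * B"
          using B[OF that] \<theta>(1) by (simp add: abs_mult)
        ultimately show ?thesis
          using coord[OF z(1) that] zi[OF z(1), of "i s"] \<theta>(3) \<eta>(2) by (simp add: abs_le_iff)
      qed
      moreover have "h z \<in> X" unfolding h_def by (rule comb_in)
      ultimately show "x \<in> U" using r(2) \<delta>(2)[of u "h z"] u UX z(2) by blast
    qed
  qed
  then have "dim L \<le> d" by (rule covering_dim_le_ball_subspace[OF L])
  moreover have "dim L = card S"
  proof -
    have "dim L = card (i ` S)"
      unfolding L_def using dim_substandard_cart[of "i ` S", where 'a = real] by (simp add: dim_vec_eq)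
    then show ?thesis using card_image[OF i] by simp
  qed
  ultimately show ?thesis by simp
qed

section \<open>Dimensions of a module with an irredundant dual basis\<close>

lemma pure_dim: "pure_dim X (card S)"
  unfolding pure_dim_def
proof (intro allI impI, elim conjE)
  fix U assume U: "openin (top_of_set X) U" "U \<noteq> {}"
  have UX: "U \<subseteq> X" using openin_subset[OF U(1)] by simp
  show "topological_dim (top_of_set U) = enat (card S)"
  proof (rule topological_dim_eqI)
    show "covering_dim_le (top_of_set U) (card S)"
      by (rule covering_dim_le_functionals[OF S(1) X functional reflect_le UX])
  qed (rule covering_dim_ge[OF U])
qed

text \<open>The coordinates carry the order of \<open>X\<close> to the pointwise order on the cone,
  so infima in \<open>X\<close> are minima of coordinates. They need not be componentwise minima in
  \<open>real ^ 'n\<close>.\<close>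

lemma isGlb_comb:
  assumes y: "cone y" and y': "cone y'"
  shows "isGlb X {ft_comb y S, ft_comb y' S} (ft_comb (\<lambda>s. min (y s) (y' s)) S)"
  unfolding isGlb_pair_iff
proof (intro conjI ballI impI)
  fix w assume w: "w \<in> X" "w \<le> ft_comb y S" "w \<le> ft_comb y' S"
  have "c s w \<le> min (y s) (y' s)" if s: "s \<in> S" for s
    using ft_functional_mono[OF X functional[OF s] w(1) comb_in w(2)]
      ft_functional_mono[OF X functional[OF s] w(1) comb_in w(3)]
      coord_comb[OF y s] coord_comb[OF y' s] by simp
  then have "ft_comb (\<lambda>s. c s w) S \<le> ft_comb (\<lambda>s. min (y s) (y' s)) S"
    by (rule ft_comb_mono[OF S(1,2)])
  then show "w \<le> ft_comb (\<lambda>s. min (y s) (y' s)) S" using basis[OF w(1)] by simp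
qed (auto intro!: comb_in ft_comb_mono[OF S(1,2)])

definition dual_gen :: "real ^ 'n \<Rightarrow> real ^ 'n" where
  "dual_gen t = ft_comb (\<lambda>s. - c t s) S"

text \<open>By the triangle inequality and the zero diagonal, \<open>c s x\<close> is the minimum
  over \<open>t\<close> of \<open>c t x - c t s\<close>; thus \<open>x\<close> is the infimum in
  \<open>X\<close> of the points \<open>dual_gen t\<close> scaled by \<open>c t x\<close>.\<close>

lemma dual_closed_hull_dual_gen: "dual_closed X hull (dual_gen ` S) = X"
proof (rule hull_unique)
  show "dual_gen ` S \<subseteq> X" unfolding dual_gen_def using comb_in by blast
  show "dual_closed X X" using X by (auto simp: dual_closed_def isGlb_pair_iff ft_submodule_def)
  fix Z assume Z: "dual_gen ` S \<subseteq> Z" "dual_closed X Z"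
  have single: "cone (\<lambda>s. a - c t s)" if "t \<in> S" for a t
    unfolding cone_def using coord_triangle[of _ t] that S(3) by (force simp: algebra_simps)
  have single_in: "ft_comb (\<lambda>s. a - c t s) S \<in> Z" if t: "t \<in> S" for a t
  proof -
    have "ft_comb (\<lambda>s. a - c t s) S = ft_scale a (dual_gen t)"
      using ft_comb_scale[OF S(1,2), of a "\<lambda>s. - c t s"] by (simp add: dual_gen_def)
    moreover have "dual_gen t \<in> Z" using Z(1) t by blast
    then have "ft_scale a (dual_gen t) \<in> Z"
      using Z(2)[unfolded dual_closed_def, THEN conjunct2] by blast
    ultimately show ?thesis by simp
  qed
  \<comment> \<open>Membership in the cone is carried through the induction because
    \<open>isGlb_comb\<close> requires it.\<close>
  have min_in: "cone (\<lambda>s. Min ((\<lambda>t. a t - c t s) ` J)) \<and> ft_comb (\<lambda>s. Min ((\<lambda>t. a t - c t s) ` J)) S \<in> Z"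
    if "finite J" "J \<noteq> {}" "J \<subseteq> S" for J a
    using that
  proof (induction rule: finite_ne_induct)
    case (singleton t)
    then show ?case using single[of t "a t"] single_in[of t "a t"] by simp
  next
    case (insert t J)
    define y where "y = (\<lambda>s. Min ((\<lambda>t. a t - c t s) ` J))"
    have y: "cone y" "ft_comb y S \<in> Z" using insert unfolding y_def by auto
    have t: "t \<in> S" using insert by simp
    have "ft_comb (\<lambda>s. min (a t - c t s) (y s)) S \<in> Z"
      using isGlb_comb[OF single[OF t, of "a t"] y(1)] single_in[OF t, of "a t"] y(2) Z(2)
      unfolding dual_closed_def by blast
    moreover have "cone (\<lambda>s. min (a t - c t s) (y s))"
      using single[OF t, of "a t"] y(1) unfolding cone_def by (fastforce simp: min_def)
    moreover have "(\<lambda>s. Min ((\<lambda>t. a t - c t s) ` insert t J)) = (\<lambda>s. min (a t - c t s) (y s))"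
      using insert by (simp add: y_def)
    ultimately show ?case by simp
  qed
  show "X \<subseteq> Z"
  proof
    fix x assume x: "x \<in> X"
    have "Min ((\<lambda>t. c t x - c t s) ` S) = c s x" if s: "s \<in> S" for s
    proof (rule Min_eqI)
      show "c s x \<in> (\<lambda>t. c t x - c t s) ` S" using s by (intro image_eqI[of _ _ s]) (simp_all add: coord_self)
      show "c s x \<le> v" if "v \<in> (\<lambda>t. c t x - c t s) ` S" for v
        using that coord_triangle[OF x _ s] by (auto simp: algebra_simps)
    qed (use S in simp)
    then have "ft_comb (\<lambda>s. Min ((\<lambda>t. c t x - c t s) ` S)) S = x"
      using basis[OF x] ft_comb_cong[of S "\<lambda>s. Min ((\<lambda>t. c t x - c t s) ` S)" "\<lambda>s. c s x"] by simp
    then show "x \<in> Z" using min_in[OF S(1,2) order_refl, of "\<lambda>t. c t x"] by simp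
  qed
qed

text \<open>The lower bound is topological: any finite dual generating set bounds the covering
  dimension of \<open>X\<close> by its size, and that dimension is at least
  \<open>card S\<close>.\<close>

lemma dual_dim: "dual_dim X = enat (card S)"
proof (rule antisym)
  have "dual_dim X \<le> enat (card (dual_gen ` S))"
    unfolding dual_dim_def using S(1) dual_closed_hull_dual_gen by (intro INF_lower) simp
  also have "\<dots> \<le> enat (card S)" using card_image_le[OF S(1)] by simp
  finally show "dual_dim X \<le> enat (card S)" .
  have "X \<noteq> {}" using S by blast
  then have "card S \<le> card T" if "finite T" "dual_closed X hull T = X" for T
    using covering_dim_ge[OF openin_subtopology_self _ covering_dim_le_dual_generators[OF X that]] by simp
  then show "enat (card S) \<le> dual_dim X"
    unfolding dual_dim_def by (intro INF_greatest) simp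
qed

end

theorem theorem1p1:
  fixes X :: "(real ^ 'n) set"
  assumes "tropical_polytope X"
  shows "ft_projective TYPE('u + real ^ 'n) (ft_of X) \<longleftrightarrow>
    (\<exists>k::nat. pure_dim X k \<and> generator_dim X = enat k \<and> dual_dim X = enat k)"
proof
  have ne: "X \<noteq> {}" and fg: "\<exists>S. finite S \<and> ft_submodule hull S = X"
    using assms unfolding tropical_polytope_def by blast+
  {
    assume proj: "ft_projective TYPE('u + real ^ 'n) (ft_of X)"
    have dim_le: "generator_dim X \<le> enat (card S')" if "finite S'" "ft_submodule hull S' = X" for S'
      unfolding generator_dim_def using that by (intro INF_lower) simp
    then obtain k where k: "generator_dim X = enat k"
      using fg by (cases "generator_dim X") auto
    then obtain S where S: "finite S" "ft_submodule hull S = X" "card S = k"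
      unfolding generator_dim_def by (rule INF_enat_attained) blast
    have least: "k \<le> card S'" if "finite S'" "ft_submodule hull S' = X" for S'
      using dim_le[OF that] k by simp
    note card_S = S(3)
    note gen = ft_polytope_generators[OF ne S(1,2)]
    obtain c where c: "\<And>s. s \<in> S \<Longrightarrow> ft_functional X (c s)"
        "\<And>x. x \<in> X \<Longrightarrow> x = ft_comb (\<lambda>s. c s x) S"
      by (rule dual_basis_if_ft_projective[OF proj gen(1) S(1) gen(2-4)]) blast+
    interpret ft_dual_basis X S c
    proof
      fix s a assume s: "s \<in> S" "S - {s} \<noteq> {}"
      show "s \<noteq> ft_comb a (S - {s})"
      proof
        assume eq: "s = ft_comb a (S - {s})"
        have sub: "S - {s} \<subseteq> ft_submodule hull (S - {s})" by (rule hull_subset)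
        have "ft_comb a (S - {s}) \<in> ft_submodule hull (S - {s})"
          using S(1) s(2) sub ft_submodule_hull by (intro ft_comb_in) auto
        then have "S \<subseteq> ft_submodule hull (S - {s})" using sub eq by auto
        then have "X \<subseteq> ft_submodule hull (S - {s})"
          unfolding S(2)[symmetric] using ft_submodule_hull by (rule hull_minimal)
        moreover have "ft_submodule hull (S - {s}) \<subseteq> X"
          unfolding S(2)[symmetric] by (rule hull_mono) blast
        ultimately have "k \<le> card (S - {s})" using S(1) by (intro least) auto
        then show False using S(1,3) s(1) by (metis card_Diff1_less not_le)
      qed
    qed (use gen S c in blast)+
    show "\<exists>k. pure_dim X k \<and> generator_dim X = enat k \<and> dual_dim X = enat k"
      using pure_dim dual_dim k unfolding card_S by blast
  }
  {
    assume "\<exists>k. pure_dim X k \<and> generator_dim X = enat k \<and> dual_dim X = enat k"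
    then obtain k where k: "pure_dim X k" "generator_dim X = enat k" "dual_dim X = enat k" by blast
    obtain S where S: "finite S" "ft_submodule hull S = X" "card S = k"
      using k(2) unfolding generator_dim_def by (rule INF_enat_attained) blast
    obtain T where T: "finite T" "dual_closed X hull T = X" "card T = k"
      using k(3) unfolding dual_dim_def by (rule INF_enat_attained) blast
    show "ft_projective TYPE('u + real ^ 'n) (ft_of X)"
      by (rule ft_projective_if_pure_dim[OF ne S T k(1)])
  }
qed

end
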